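(* Suppose $\Sigma$ and $\Sigma'$ are scaffoldings for a graph of group actions $\mathcal G$. If $G$ and $G'$ are the universal groups of $\mathcal G$ defined with respect to $\Sigma$ and $\Sigma'$, respectively, then $G$ and $G'$ are isomorphic, and their actions on $\Sigma$ and $\Sigma'$, respectively, are isomorphic, where the isomorphism is given by an acceptable scaffolding isomorphism $\Sigma\to\Sigma'$ (i.e. there are an acceptable scaffolding isomorphism $\Phi\colon\Sigma\to\Sigma'$ and a group isomorphism $\varphi\colon G\to G'$ with $\varphi(g)(\Phi(x))=\Phi(g(x))$ for all $g\in G$ and all $x$ in $\Sigma$).
   Context: **Graphs.** A graph $\Gamma$ has a vertex set $V\Gamma$, an arc set $A\Gamma$, maps $o,t\colon A\Gamma\to V\Gamma$ (origin, terminus) and an involution $a\mapsto\bar a$ on arcs with $o(a)=t(\bar a)$; an arc with $\bar a=a$ is called self-reverse (loops with $\bar a\ne a$ are also allowed). Graph morphisms preserve $o$, $t$ and reversal. A tree is a connected graph without loops and without two arcs having the same origin and the same terminus, which has no simple cycles of length $\ge 3$. **Group actions.** A permutation group action $(G,X)$ is a faithful action of a group $G$ on a non-empty set $X$. For $Y\subseteq X$, $G^Y$ is the permutation group induced on $Y$ by the setwise stabiliser of $Y$ in $G$. An embedding $(H,Y)\hookrightarrow(G,X)$ of permutation group actions is given by an injection $\Phi\colon Y\to X$ such that $h\mapsto \Phi h\Phi^{-1}$ is an isomorphism from $H$ onto $G^{\Phi(Y)}$. **Graph of group actions (gga).** A gga $\mathcal G$ consists of: a connected graph $\Delta$ (base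 graph); for every $v\in V\Delta$ a permutation group action $(G(v),X(v))$; for every $a\in A\Delta$ a permutation group action $(H(a),Y(a))$ with $(H(\bar a),Y(\bar a))=(H(a),Y(a))$ and an embedding $\Phi_a\colon(H(a),Y(a))\hookrightarrow(G(t(a)),X(t(a)))$; and for every self-reverse arc $a$ a permutation $h_a$ of $Y(a)$ with $h_aH(a)h_a^{-1}=H(a)$ and $h_a^2\in H(a)$ (inversion agent). An $a$-adhesion map is a map $g\Phi_a\colon Y(a)\to X(t(a))$ with $g\in G(t(a))$; its image is called an $a$-adhesion set. If $a$ is self-reverse, a twisted $a$-adhesion map is a map $g\Phi_ah_a$ with $g\in G(t(a))$. **Scaffolding.** A scaffolding $(\Sigma,\sim,\pi,p)$ for $\mathcal G$ is a graph $\Sigma$ with an equivalence relation $\sim$ on $V\Sigma$, extended to $A\Sigma$ by $a\sim a'$ iff $o(a)\sim o(a')$ and $t(a)\sim t(a')$ (write $[x]$ for the class of $x$ as a set, called a vertex or arc bundle, and $\llbracket x\rrbracket$ for the class as a vertex or arc of $T_\Sigma:=\Sigma/\!\sim$), such that: (i) $T_\Sigma$ is a tree; (ii) no arc of $\Sigma$ has both ends in the same vertex bundle; (iii) $\pi\colon T_\Sigma\to\Delta$ is a graph morphism; (iv) $p$ (a legal colouring) is a map from $V\Sigma\cup A\Sigma$ to $\bigcup_v X(v)\cup\bigcup_a Y(a)$ such that: $p$ restricts to bijections $[v]\to X(\pi(\llbracket v\rrbracket))$ and $[a]\to Y(\pi(\llbracket a\rrbracket))$ for all vertices $v$ and arcs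 $a$ of $\Sigma$; $p(\bar b)=p(b)$ for every arc $b$; if $\Psi_{\llbracket a\rrbracket}\colon Y(\pi(\llbracket a\rrbracket))\to X(\pi(t(\llbracket a\rrbracket)))$ is the unique map with $\Psi_{\llbracket a\rrbracket}(p(b))=p(t(b))$ for all $b\in[a]$, then $\Psi_{\llbracket a\rrbracket}$ is a $\pi(\llbracket a\rrbracket)$-adhesion map when $\pi(\llbracket a\rrbracket)$ is not self-reverse, while when $\pi(\llbracket a\rrbracket)$ is self-reverse one of $\Psi_{\llbracket a\rrbracket},\Psi_{\llbracket\bar a\rrbracket}$ is a $\pi(\llbracket a\rrbracket)$-adhesion map and the other is a twisted $\pi(\llbracket a\rrbracket)$-adhesion map; and for every vertex $\llbracket v\rrbracket$ of $T_\Sigma$, every $b\in A\Delta$ with $t(b)=\pi(\llbracket v\rrbracket)$ and every $b$-adhesion set $S$, there is exactly one arc $\llbracket a\rrbracket$ of $T_\Sigma$ with $t(\llbracket a\rrbracket)=\llbracket v\rrbracket$, $\pi(\llbracket a\rrbracket)=b$ and $\Psi_{\llbracket a\rrbracket}(Y(b))=S$. **Universal group.** A scaffolding isomorphism $f\colon(\Sigma,\sim,\pi,p)\to(\Sigma',\sim',\pi',p')$ between scaffoldings for the same $\mathcal G$ is a graph isomorphism with $x\sim y\iff f(x)\sim'f(y)$ and $\pi(\llbracket x\rrbracket)=\pi'(\llbracket f(x)\rrbracket)$ for all vertices and arcs $x,y$. Its local map at $\llbracket v\rrbracket$ is the permutation $f_{\llbracket v\rrbracket}$ of $X(\pi(\llbracket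 v\rrbracket))$ with $f_{\llbracket v\rrbracket}(p(x))=p'(f(x))$ for all $x\in[v]$; $f$ is acceptable if $f_{\llbracket v\rrbracket}\in G(\pi(\llbracket v\rrbracket))$ for every vertex $\llbracket v\rrbracket$ of $T_\Sigma$. The universal group of $\mathcal G$ defined with respect to $\Sigma$ is the group of all acceptable scaffolding isomorphisms $\Sigma\to\Sigma$. *)

theory Defs
  imports "HOL-Algebra.Group_Action" "Graph_Theory.Digraph_Component"
begin

section \<open>Graphs with arc reversal\<close>

text \<open>
  The origin and the terminus of an arc are \<open>tail\<close> and \<open>head\<close>. The locale
  \<^locale>\<open>bidirected_digraph\<close> is not used because it excludes self-reverse arcs.
  Predicates of the graph library only apply to unextended records, whence the truncations.
\<close>

record ('v, 'a) rev_digraph = "('v, 'a) pre_digraph" +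
  arev :: "'a \<Rightarrow> 'a"

locale reversal_graph =
  fixes \<Gamma> :: "('v, 'a) rev_digraph"
  assumes wf: "wf_digraph (pre_digraph.truncate \<Gamma>)"
    and arev_in_arcs: "a \<in> arcs \<Gamma> \<Longrightarrow> arev \<Gamma> a \<in> arcs \<Gamma>"
    and arev_arev: "a \<in> arcs \<Gamma> \<Longrightarrow> arev \<Gamma> (arev \<Gamma> a) = a"
    and tail_eq: "a \<in> arcs \<Gamma> \<Longrightarrow> tail \<Gamma> a = head \<Gamma> (arev \<Gamma> a)"

text \<open>The library notion of connectedness entails non-emptiness.\<close>

definition connected_rgraph :: "('v, 'a) rev_digraph \<Rightarrow> bool" where
  "connected_rgraph \<Gamma> \<longleftrightarrow>
    reversal_graph \<Gamma> \<and> Digraph_Component.connected (pre_digraph.truncate \<Gamma>)"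

definition tree_rgraph :: "('v, 'a) rev_digraph \<Rightarrow> bool" where
  "tree_rgraph \<Gamma> \<longleftrightarrow>
    connected_rgraph \<Gamma> \<and>
    loopfree_digraph (pre_digraph.truncate \<Gamma>) \<and>
    nomulti_digraph (pre_digraph.truncate \<Gamma>) \<and>
    (\<nexists>c. pre_digraph.cycle (pre_digraph.truncate \<Gamma>) c \<and> length c \<ge> 3)"

definition rgraph_morphism ::
    "('v, 'a) rev_digraph \<Rightarrow> ('w, 'b) rev_digraph \<Rightarrow> ('v \<Rightarrow> 'w) \<Rightarrow> ('a \<Rightarrow> 'b) \<Rightarrow> bool" where
  "rgraph_morphism \<Gamma> \<Gamma>' f g \<longleftrightarrow>
    f \<in> verts \<Gamma> \<rightarrow> verts \<Gamma>' \<and> g \<in> arcs \<Gamma> \<rightarrow> arcs \<Gamma>' \<and>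
    (\<forall>a\<in>arcs \<Gamma>. tail \<Gamma>' (g a) = f (tail \<Gamma> a) \<and> head \<Gamma>' (g a) = f (head \<Gamma> a) \<and>
      arev \<Gamma>' (g a) = g (arev \<Gamma> a))"

definition rgraph_iso ::
    "('v, 'a) rev_digraph \<Rightarrow> ('w, 'b) rev_digraph \<Rightarrow> ('v \<Rightarrow> 'w) \<Rightarrow> ('a \<Rightarrow> 'b) \<Rightarrow> bool" where
  "rgraph_iso \<Gamma> \<Gamma>' f g \<longleftrightarrow>
    rgraph_morphism \<Gamma> \<Gamma>' f g \<and>
    bij_betw f (verts \<Gamma>) (verts \<Gamma>') \<and> bij_betw g (arcs \<Gamma>) (arcs \<Gamma>')"


section \<open>Permutation group actions\<close>

text \<open>
  A faithful action is identified with the group of permutations through which it acts; the two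
  lemmas below relate this to \<^locale>\<open>faithful_action\<close>. As in \<^const>\<open>BijGroup\<close>, permutations of
  \<open>X\<close> are extensional functions.
\<close>

definition perm_group_action :: "('x \<Rightarrow> 'x) set \<Rightarrow> 'x set \<Rightarrow> bool" where
  "perm_group_action G X \<longleftrightarrow> X \<noteq> {} \<and> subgroup G (BijGroup X)"

definition perm_group :: "('x \<Rightarrow> 'x) set \<Rightarrow> 'x set \<Rightarrow> ('x \<Rightarrow> 'x) monoid" where
  "perm_group G X = (BijGroup X)\<lparr>carrier := G\<rparr>"

lemma faithful_action_imp_perm_group_action:
  assumes "faithful_action G X \<phi>" "X \<noteq> {}"
  shows "perm_group_action (\<phi> ` carrier G) X" "\<phi> \<in> Group.iso G (perm_group (\<phi> ` carrier G) X)"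
proof -
  interpret faithful_action G X \<phi> by (rule assms)
  interpret group_hom G "BijGroup X" \<phi> by (rule group_hom)
  show "perm_group_action (\<phi> ` carrier G) X"
    using assms(2) img_is_subgroup by (simp add: perm_group_action_def)
  show "\<phi> \<in> Group.iso G (perm_group (\<phi> ` carrier G) X)"
    using faithful by (auto simp: Group.iso_def hom_def perm_group_def bij_betw_def)
qed

lemma perm_group_action_imp_faithful_action:
  assumes "perm_group_action G X"
  shows "faithful_action (perm_group G X) X (\<lambda>g. g)"
proof -
  interpret subgroup G "BijGroup X" using assms by (simp add: perm_group_action_def)
  have "group (perm_group G X)"
    unfolding perm_group_def by (rule subgroup_is_group[OF group_BijGroup])
  then have "group_hom (perm_group G X) (BijGroup X) (\<lambda>g. g)"
    by (intro group_hom.intro group_BijGroup group_hom_axioms.intro)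
      (auto simp: perm_group_def hom_def)
  then show ?thesis
    by (intro faithful_action.intro group_action.intro faithful_action_axioms.intro inj_onI) auto
qed

text \<open>The group induced on \<open>Y\<close> by the setwise stabiliser of \<open>Y\<close>.\<close>

definition induced_perms :: "('x \<Rightarrow> 'x) set \<Rightarrow> 'x set \<Rightarrow> ('x \<Rightarrow> 'x) set" where
  "induced_perms G Y = {restrict g Y | g. g \<in> G \<and> g ` Y = Y}"

definition perm_group_embedding ::
    "('y \<Rightarrow> 'y) set \<Rightarrow> 'y set \<Rightarrow> ('x \<Rightarrow> 'x) set \<Rightarrow> 'x set \<Rightarrow> ('y \<Rightarrow> 'x) \<Rightarrow> bool" where
  "perm_group_embedding H Y G X \<Phi> \<longleftrightarrow>
    \<Phi> \<in> Y \<rightarrow> X \<and> inj_on \<Phi> Y \<and>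
    (\<lambda>h. \<lambda>x \<in> \<Phi> ` Y. \<Phi> (h (inv_into Y \<Phi> x)))
      \<in> Group.iso (perm_group H Y) (perm_group (induced_perms G (\<Phi> ` Y)) (\<Phi> ` Y))"


section \<open>Graphs of group actions\<close>

record ('v, 'a, 'x, 'y) gga =
  base :: "('v, 'a) rev_digraph"
  vgrp :: "'v \<Rightarrow> ('x \<Rightarrow> 'x) set"
  vset :: "'v \<Rightarrow> 'x set"
  agrp :: "'a \<Rightarrow> ('y \<Rightarrow> 'y) set"
  aset :: "'a \<Rightarrow> 'y set"
  emb :: "'a \<Rightarrow> 'y \<Rightarrow> 'x"
  agent :: "'a \<Rightarrow> 'y \<Rightarrow> 'y"

definition self_reverse :: "('v, 'a, 'x, 'y) gga \<Rightarrow> 'a \<Rightarrow> bool" where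
  "self_reverse \<G> a \<longleftrightarrow> arev (base \<G>) a = a"

locale graph_of_group_actions =
  fixes \<G> :: "('v, 'a, 'x, 'y) gga"
  assumes connected_base: "connected_rgraph (base \<G>)"
    and vertex_action: "v \<in> verts (base \<G>) \<Longrightarrow> perm_group_action (vgrp \<G> v) (vset \<G> v)"
    and arc_action: "a \<in> arcs (base \<G>) \<Longrightarrow> perm_group_action (agrp \<G> a) (aset \<G> a)"
    and arc_action_rev: "a \<in> arcs (base \<G>) \<Longrightarrow>
      agrp \<G> (arev (base \<G>) a) = agrp \<G> a \<and> aset \<G> (arev (base \<G>) a) = aset \<G> a"
    and embedding: "a \<in> arcs (base \<G>) \<Longrightarrow>
      perm_group_embedding (agrp \<G> a) (aset \<G> a)
        (vgrp \<G> (head (base \<G>) a)) (vset \<G> (head (base \<G>) a)) (emb \<G> a)"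
    and agent_perm: "a \<in> arcs (base \<G>) \<Longrightarrow> self_reverse \<G> a \<Longrightarrow> agent \<G> a \<in> Bij (aset \<G> a)"
    and agent_normalises: "a \<in> arcs (base \<G>) \<Longrightarrow> self_reverse \<G> a \<Longrightarrow>
      {agent \<G> a \<otimes>\<^bsub>BijGroup (aset \<G> a)\<^esub> h \<otimes>\<^bsub>BijGroup (aset \<G> a)\<^esub>
        inv\<^bsub>BijGroup (aset \<G> a)\<^esub> (agent \<G> a) | h. h \<in> agrp \<G> a} = agrp \<G> a"
    and agent_square: "a \<in> arcs (base \<G>) \<Longrightarrow> self_reverse \<G> a \<Longrightarrow>
      agent \<G> a \<otimes>\<^bsub>BijGroup (aset \<G> a)\<^esub> agent \<G> a \<in> agrp \<G> a"

definition adhesion_maps :: "('v, 'a, 'x, 'y) gga \<Rightarrow> 'a \<Rightarrow> ('y \<Rightarrow> 'x) set" where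
  "adhesion_maps \<G> a =
    {\<lambda>y \<in> aset \<G> a. g (emb \<G> a y) | g. g \<in> vgrp \<G> (head (base \<G>) a)}"

definition twisted_adhesion_maps :: "('v, 'a, 'x, 'y) gga \<Rightarrow> 'a \<Rightarrow> ('y \<Rightarrow> 'x) set" where
  "twisted_adhesion_maps \<G> a =
    {\<lambda>y \<in> aset \<G> a. g (emb \<G> a (agent \<G> a y)) | g. g \<in> vgrp \<G> (head (base \<G>) a)}"

definition adhesion_sets :: "('v, 'a, 'x, 'y) gga \<Rightarrow> 'a \<Rightarrow> 'x set set" where
  "adhesion_sets \<G> a = (\<lambda>\<psi>. \<psi> ` aset \<G> a) ` adhesion_maps \<G> a"


section \<open>Scaffoldings\<close>

text \<open>
  The projection and the colouring are split into their parts on vertices and on arcs. The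
  vertices and arcs of the quotient graph are the vertex bundles and arc bundles themselves.
\<close>

record ('v, 'a, 'x, 'y, 's, 'r) scaffold =
  sgraph :: "('s, 'r) rev_digraph"
  sim :: "'s rel"
  vproj :: "'s set \<Rightarrow> 'v"
  aproj :: "'r set \<Rightarrow> 'a"
  vcol :: "'s \<Rightarrow> 'x"
  acol :: "'r \<Rightarrow> 'y"

definition asim :: "('v, 'a, 'x, 'y, 's, 'r) scaffold \<Rightarrow> 'r rel" where
  "asim \<S> = {(a, b). a \<in> arcs (sgraph \<S>) \<and> b \<in> arcs (sgraph \<S>) \<and>
    (tail (sgraph \<S>) a, tail (sgraph \<S>) b) \<in> sim \<S> \<and>
    (head (sgraph \<S>) a, head (sgraph \<S>) b) \<in> sim \<S>}"

abbreviation vbundle :: "('v, 'a, 'x, 'y, 's, 'r) scaffold \<Rightarrow> 's \<Rightarrow> 's set" where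
  "vbundle \<S> v \<equiv> sim \<S> `` {v}"

abbreviation abundle :: "('v, 'a, 'x, 'y, 's, 'r) scaffold \<Rightarrow> 'r \<Rightarrow> 'r set" where
  "abundle \<S> a \<equiv> asim \<S> `` {a}"

text \<open>
  All arcs of an arc bundle have their origins in one vertex bundle, which is therefore the
  saturation of the set of these origins; likewise for the termini.
\<close>

definition quotient_graph ::
    "('v, 'a, 'x, 'y, 's, 'r) scaffold \<Rightarrow> ('s set, 'r set) rev_digraph" where
  "quotient_graph \<S> = \<lparr>
    verts = verts (sgraph \<S>) // sim \<S>,
    arcs = arcs (sgraph \<S>) // asim \<S>,
    tail = (\<lambda>B. sim \<S> `` (tail (sgraph \<S>) ` B)),
    head = (\<lambda>B. sim \<S> `` (head (sgraph \<S>) ` B)),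
    arev = (\<lambda>B. arev (sgraph \<S>) ` B)\<rparr>"

text \<open>The map \<open>\<Psi>\<close> of an arc bundle \<open>B\<close>.\<close>

definition bundle_map ::
    "('v, 'a, 'x, 'y) gga \<Rightarrow> ('v, 'a, 'x, 'y, 's, 'r) scaffold \<Rightarrow> 'r set \<Rightarrow> 'y \<Rightarrow> 'x" where
  "bundle_map \<G> \<S> B = (THE \<psi>. \<psi> \<in> extensional (aset \<G> (aproj \<S> B)) \<and>
    (\<forall>b\<in>B. \<psi> (acol \<S> b) = vcol \<S> (head (sgraph \<S>) b)))"

locale scaffolding =
  fixes \<G> :: "('v, 'a, 'x, 'y) gga"
    and \<S> :: "('v, 'a, 'x, 'y, 's, 'r) scaffold"
  assumes reversal_graph: "reversal_graph (sgraph \<S>)"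
    and equiv_sim: "equiv (verts (sgraph \<S>)) (sim \<S>)"
    and tree: "tree_rgraph (quotient_graph \<S>)"
    and ends_not_sim: "a \<in> arcs (sgraph \<S>) \<Longrightarrow>
      (tail (sgraph \<S>) a, head (sgraph \<S>) a) \<notin> sim \<S>"
    and proj_morphism:
      "rgraph_morphism (quotient_graph \<S>) (base \<G>) (vproj \<S>) (aproj \<S>)"
    and vcol_bij: "C \<in> verts (quotient_graph \<S>) \<Longrightarrow> bij_betw (vcol \<S>) C (vset \<G> (vproj \<S> C))"
    and acol_bij: "B \<in> arcs (quotient_graph \<S>) \<Longrightarrow> bij_betw (acol \<S>) B (aset \<G> (aproj \<S> B))"
    and acol_arev: "b \<in> arcs (sgraph \<S>) \<Longrightarrow> acol \<S> (arev (sgraph \<S>) b) = acol \<S> b"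
    and bundle_map_adhesion:
      "B \<in> arcs (quotient_graph \<S>) \<Longrightarrow> \<not> self_reverse \<G> (aproj \<S> B) \<Longrightarrow>
        bundle_map \<G> \<S> B \<in> adhesion_maps \<G> (aproj \<S> B)"
    and bundle_map_self_reverse:
      "B \<in> arcs (quotient_graph \<S>) \<Longrightarrow> self_reverse \<G> (aproj \<S> B) \<Longrightarrow>
        bundle_map \<G> \<S> B \<in> adhesion_maps \<G> (aproj \<S> B) \<and>
        bundle_map \<G> \<S> (arev (quotient_graph \<S>) B) \<in> twisted_adhesion_maps \<G> (aproj \<S> B) \<or>
        bundle_map \<G> \<S> (arev (quotient_graph \<S>) B) \<in> adhesion_maps \<G> (aproj \<S> B) \<and>
        bundle_map \<G> \<S> B \<in> twisted_adhesion_maps \<G> (aproj \<S> B)"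
    and unique_arc:
      "C \<in> verts (quotient_graph \<S>) \<Longrightarrow> e \<in> arcs (base \<G>) \<Longrightarrow>
        head (base \<G>) e = vproj \<S> C \<Longrightarrow> A \<in> adhesion_sets \<G> e \<Longrightarrow>
        \<exists>!B. B \<in> arcs (quotient_graph \<S>) \<and> head (quotient_graph \<S>) B = C \<and>
          aproj \<S> B = e \<and> bundle_map \<G> \<S> B ` aset \<G> e = A"


section \<open>Universal groups\<close>

text \<open>A map between graphs is the pair of its vertex part and its arc part.\<close>

definition scaffolding_iso ::
    "('v, 'a, 'x, 'y, 's, 'r) scaffold \<Rightarrow> ('v, 'a, 'x, 'y, 't, 'q) scaffold \<Rightarrow>
      ('s \<Rightarrow> 't) \<times> ('r \<Rightarrow> 'q) \<Rightarrow> bool" where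
  "scaffolding_iso \<S> \<S>' f \<longleftrightarrow>
    rgraph_iso (sgraph \<S>) (sgraph \<S>') (fst f) (snd f) \<and>
    (\<forall>x\<in>verts (sgraph \<S>). \<forall>y\<in>verts (sgraph \<S>).
      (x, y) \<in> sim \<S> \<longleftrightarrow> (fst f x, fst f y) \<in> sim \<S>') \<and>
    (\<forall>x\<in>arcs (sgraph \<S>). \<forall>y\<in>arcs (sgraph \<S>).
      (x, y) \<in> asim \<S> \<longleftrightarrow> (snd f x, snd f y) \<in> asim \<S>') \<and>
    (\<forall>x\<in>verts (sgraph \<S>). vproj \<S> (vbundle \<S> x) = vproj \<S>' (vbundle \<S>' (fst f x))) \<and>
    (\<forall>x\<in>arcs (sgraph \<S>). aproj \<S> (abundle \<S> x) = aproj \<S>' (abundle \<S>' (snd f x)))"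

definition local_map ::
    "('v, 'a, 'x, 'y) gga \<Rightarrow> ('v, 'a, 'x, 'y, 's, 'r) scaffold \<Rightarrow>
      ('v, 'a, 'x, 'y, 't, 'q) scaffold \<Rightarrow>
      ('s \<Rightarrow> 't) \<times> ('r \<Rightarrow> 'q) \<Rightarrow> 's set \<Rightarrow> 'x \<Rightarrow> 'x" where
  "local_map \<G> \<S> \<S>' f C = (THE \<sigma>. \<sigma> \<in> extensional (vset \<G> (vproj \<S> C)) \<and>
    (\<forall>x\<in>C. \<sigma> (vcol \<S> x) = vcol \<S>' (fst f x)))"

definition acceptable_iso ::
    "('v, 'a, 'x, 'y) gga \<Rightarrow> ('v, 'a, 'x, 'y, 's, 'r) scaffold \<Rightarrow>
      ('v, 'a, 'x, 'y, 't, 'q) scaffold \<Rightarrow> ('s \<Rightarrow> 't) \<times> ('r \<Rightarrow> 'q) \<Rightarrow> bool" where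
  "acceptable_iso \<G> \<S> \<S>' f \<longleftrightarrow>
    scaffolding_iso \<S> \<S>' f \<and>
    (\<forall>C\<in>verts (quotient_graph \<S>). local_map \<G> \<S> \<S>' f C \<in> vgrp \<G> (vproj \<S> C))"

text \<open>
  The ambient product of symmetric groups supplies composition and makes both parts of a map
  extensional, so that maps agreeing on the graph are equal.
\<close>

definition universal_group ::
    "('v, 'a, 'x, 'y) gga \<Rightarrow> ('v, 'a, 'x, 'y, 's, 'r) scaffold \<Rightarrow>
      (('s \<Rightarrow> 's) \<times> ('r \<Rightarrow> 'r)) monoid" where
  "universal_group \<G> \<S> =
    (BijGroup (verts (sgraph \<S>)) \<times>\<times> BijGroup (arcs (sgraph \<S>)))
      \<lparr>carrier := {f \<in> Bij (verts (sgraph \<S>)) \<times> Bij (arcs (sgraph \<S>)). acceptable_iso \<G> \<S> \<S> f}\<rparr>"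

end

theory Submission
  imports Defs
begin

text \<open>
  An acceptable isomorphism is built bundle by bundle along the trees of the two scaffoldings. At a
  vertex bundle with local map \<open>g\<close>, the arc bundle over \<open>e\<close> with adhesion set
  \<open>A\<close> must go to the unique arc bundle over \<open>e\<close> with adhesion set \<open>g ` A\<close>. This forces a
  permutation \<open>k\<close> of the colours on that arc bundle, which lies in the arc group up to the
  inversion agents in play and therefore extends to a local map at the other end. The resulting map
  of trees is bijective on stars, hence an isomorphism. Conjugation by the isomorphism of
  scaffoldings so obtained carries one universal group to the other.
\<close>

section \<open>Rooted trees\<close>

text \<open>The obstacle is the self-reverse arcs. Of the two directions of an arc bundle over such
  an arc, one carries an adhesion map and the other a twisted one, and nothing says which. Two
  scaffoldings may decide differently, so \<open>k\<close> itself need not lie in the arc group.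
  Both directions are therefore treated together, as a pair with twists \<open>(id, h)\<close> or
  \<open>(h, id)\<close>, where \<open>h\<close> is the agent. Passing from one end to the other
  multiplies an element of the arc group by one factor \<open>h\<close> or its inverse on each side;
  these two factors are absorbed because \<open>h\<close> normalises the arc group and squares into
  it. An extension to the other end is not unique, so a local map has to be chosen and remembered
  with the image of each vertex bundle: this is the state carried along the tree. Bijectivity on
  stars comes from both halves of the axiom on arcs with a prescribed adhesion set, existence and
  uniqueness. It becomes global because a map of trees that is injective on stars cannot fold and so
  keeps the distance from the root.\<close>

lemma truncate_sel [simp]:
  "verts (pre_digraph.truncate T) = verts T"
  "arcs (pre_digraph.truncate T) = arcs T"
  "tail (pre_digraph.truncate T) = tail T"
  "head (pre_digraph.truncate T) = head T"
  by (simp_all add: pre_digraph.truncate_def)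

text \<open>These are the properties of the distance to \<open>r\<close> that a recursion along the
  tree needs. A parent arc has the child as its tail and the parent as its head. The absence of
  cycles reaches \<open>tree_lifting\<close> only through the last clause and the fact that no arc
  stays on one level.\<close>

definition tree_rank :: "('v, 'a) rev_digraph \<Rightarrow> 'v \<Rightarrow> ('v \<Rightarrow> nat) \<Rightarrow> bool" where
  "tree_rank T r d \<longleftrightarrow> d r = 0 \<and>
    (\<forall>v\<in>verts T. v \<noteq> r \<longrightarrow> (\<exists>a\<in>arcs T. tail T a = v \<and> d v = Suc (d (head T a)))) \<and>
    (\<forall>a\<in>arcs T. d (tail T a) = Suc (d (head T a)) \<or> d (head T a) = Suc (d (tail T a))) \<and>
    (\<forall>a\<in>arcs T. \<forall>b\<in>arcs T. tail T a = tail T b \<longrightarrow>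
      d (head T a) < d (tail T a) \<longrightarrow> d (head T b) < d (tail T b) \<longrightarrow> a = b)"

context reversal_graph
begin

sublocale wf_digraph "pre_digraph.truncate \<Gamma>"
  by (rule wf)

lemma tail_in: "a \<in> arcs \<Gamma> \<Longrightarrow> tail \<Gamma> a \<in> verts \<Gamma>"
  and head_in: "a \<in> arcs \<Gamma> \<Longrightarrow> head \<Gamma> a \<in> verts \<Gamma>"
  using tail_in_verts head_in_verts by auto

lemma tail_arev: "a \<in> arcs \<Gamma> \<Longrightarrow> tail \<Gamma> (arev \<Gamma> a) = head \<Gamma> a"
  using tail_eq[OF arev_in_arcs] by (simp add: arev_arev)

lemma head_arev: "a \<in> arcs \<Gamma> \<Longrightarrow> head \<Gamma> (arev \<Gamma> a) = tail \<Gamma> a"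
  using tail_eq by simp

text \<open>Library connectedness refers to the symmetric closure. Since every arc has a reverse,
  the graph is already symmetric, and directed walks exist.\<close>

lemma connected_reachable:
  assumes "connected_rgraph \<Gamma>" "u \<in> verts \<Gamma>" "v \<in> verts \<Gamma>"
  shows "reachable (pre_digraph.truncate \<Gamma>) u v"
proof -
  have "symmetric (pre_digraph.truncate \<Gamma>)"
    unfolding symmetric_conv
    by (auto simp: tail_arev head_arev intro!: bexI[of _ "arev \<Gamma> _"] arev_in_arcs)
  moreover have "Digraph_Component.connected (pre_digraph.truncate \<Gamma>)"
    using assms(1) by (simp add: connected_rgraph_def)
  ultimately have "strongly_connected (pre_digraph.truncate \<Gamma>)"
    by (rule symmetric_connected_imp_strongly_connected)
  then show ?thesis
    using assms(2,3) by (auto simp: strongly_connected_def)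
qed

end

lemma connected_rgraph_nonempty: "connected_rgraph \<Gamma> \<Longrightarrow> verts \<Gamma> \<noteq> {}"
  by (auto simp: connected_rgraph_def connected_def strongly_connected_def)

section \<open>Distance to a root in a tree\<close>

locale rev_tree =
  fixes T :: "('v, 'a) rev_digraph"
  assumes tree: "tree_rgraph T"
begin

sublocale reversal_graph T
  using tree by (simp add: tree_rgraph_def connected_rgraph_def)

lemma connected: "connected_rgraph T"
  using tree by (simp add: tree_rgraph_def)

lemma tail_neq_head: "a \<in> arcs T \<Longrightarrow> tail T a \<noteq> head T a"
  using tree loopfree_digraph.no_loops[of "pre_digraph.truncate T" a]
  by (auto simp: tree_rgraph_def)

lemma arc_eqI:
  "a \<in> arcs T \<Longrightarrow> b \<in> arcs T \<Longrightarrow> tail T a = tail T b \<Longrightarrow> head T a = head T b \<Longrightarrow> a = b"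
  using tree nomulti_digraph.no_multi_arcs[of "pre_digraph.truncate T" a b]
  by (auto simp: tree_rgraph_def arc_to_ends_def)

lemma walk_exists: "u \<in> verts T \<Longrightarrow> v \<in> verts T \<Longrightarrow> \<exists>p. awalk u p v"
  using connected_reachable[OF connected] by (simp add: reachable_awalk)

text \<open>\<open>E\<close> is adjacency in the tree with \<open>v\<close> deleted. A connection
  between two neighbours of \<open>v\<close> that avoids \<open>v\<close> would close up through
  \<open>v\<close> to a simple cycle. This is where cycle-freeness is used.\<close>

lemma neighbours_separated:
  assumes ab: "a \<in> arcs T" "b \<in> arcs T" "tail T a = v" "tail T b = v" "a \<noteq> b"
    and E: "E = {(tail T c, head T c) | c. c \<in> arcs T \<and> tail T c \<noteq> v \<and> head T c \<noteq> v}"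
  shows "(head T a, head T b) \<notin> E\<^sup>*"
proof
  let ?u = "head T a" and ?w = "head T b"
  assume "(?u, ?w) \<in> E\<^sup>*"
  moreover have "?w \<noteq> v" "?u \<noteq> ?w" "?w \<in> verts T" "?u \<noteq> v"
    using ab arc_eqI tail_neq_head head_in by metis+
  \<comment> \<open>A chain in \<open>E\<close> is turned into a library walk that remembers that it
    avoids \<open>v\<close>.\<close>
  moreover have "\<exists>p. awalk x p ?w \<and> (\<forall>c\<in>set p. tail T c \<noteq> v \<and> head T c \<noteq> v)"
    if "(x, ?w) \<in> E\<^sup>*" for x
    using that
  proof (induction rule: converse_rtrancl_induct)
    case base
    then show ?case
      using \<open>?w \<in> verts T\<close>
      by (intro exI[of _ "[]"]) (auto simp: awalk_Nil_iff)
  next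
    case (step x y)
    then obtain c p where "c \<in> arcs T" "tail T c = x" "head T c = y" "x \<noteq> v" "y \<noteq> v"
      "awalk y p ?w" "\<forall>c\<in>set p. tail T c \<noteq> v \<and> head T c \<noteq> v"
      using E by auto
    then show ?case
      by (intro exI[of _ "c # p"]) (auto simp: awalk_Cons_iff)
  qed
  ultimately obtain p where p: "awalk ?u p ?w" "\<forall>c\<in>set p. tail T c \<noteq> v \<and> head T c \<noteq> v"
    by blast
  \<comment> \<open>A \<open>cycle\<close> must not repeat vertices, hence the passage to a path;
    its arcs are among those of \<open>p\<close> and still avoid \<open>v\<close>.\<close>
  define q where "q = awalk_to_apath p"
  have q: "apath ?u q ?w" "set q \<subseteq> set p"
    using apath_awalk_to_apath[OF p(1)] awalk_to_apath_subset[OF p(1)] by (simp_all add: q_def)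
  have "q \<noteq> []" using q(1) \<open>?u \<noteq> ?w\<close> by (auto simp: apath_Nil_iff)
  have qw: "awalk ?u q ?w" "distinct (awalk_verts ?u q)" using q(1) by (auto simp: apath_def)
  have "v \<notin> set (awalk_verts ?u q)"
    using set_awalk_verts[OF qw(1)] p(2) q(2) \<open>?u \<noteq> v\<close>
    by auto
  moreover have bv: "awalk ?w [arev T b] v"
    using ab tail_arev[OF ab(2)] head_arev[OF ab(2)] arev_in_arcs[OF ab(2)] tail_in[OF ab(2)]
      head_in[OF ab(2)]
    by (auto simp: awalk_simps)
  moreover have qb: "awalk ?u (q @ [arev T b]) v"
    using awalk_appendI[OF qw(1) bv] .
  moreover have "awalk v (a # q @ [arev T b]) v"
    using qb ab tail_in[OF ab(1)] by (auto simp: awalk_Cons_iff)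
  moreover have "awalk_verts ?u (q @ [arev T b]) = awalk_verts ?u q @ [v]"
    using awalk_verts_append[OF qb] head_arev[OF ab(2)] ab
    by simp
  ultimately have "cycle (a # q @ [arev T b])"
    unfolding cycle_def using qw(2) by (intro exI[of _ v]) auto
  \<comment> \<open>The neighbours are distinct, so \<open>q\<close> contributes at least one arc
    besides \<open>a\<close> and the reverse of \<open>b\<close>. Going back and forth along one
    edge is thereby excluded.\<close>
  moreover have "length (a # q @ [arev T b]) \<ge> 3"
    using \<open>q \<noteq> []\<close> by (cases q) auto
  ultimately show False using tree by (auto simp: tree_rgraph_def)
qed

text \<open>The rank is the length of a shortest walk to \<open>r\<close>. All clauses beyond the
  triangle inequality rest on one fact: no vertex has two arcs to neighbours that are at most as far
  from \<open>r\<close>, since both neighbours would be connected to \<open>r\<close>, and hence to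
  each other, without passing through that vertex.\<close>

lemma rank_exists:
  assumes r: "r \<in> verts T"
  shows "\<exists>d. tree_rank T r d"
proof -
  define d where "d v = (LEAST n. \<exists>p. awalk v p r \<and> length p = n)" for v
  have d_le: "d v \<le> length p" if "awalk v p r" for v p
    unfolding d_def by (rule Least_le) (use that in blast)
  have geodesic: "\<exists>p. awalk v p r \<and> length p = d v" if v: "v \<in> verts T" for v
    unfolding d_def by (rule LeastI_ex) (use walk_exists[OF v r] in blast)
  have triangle: "d (tail T a) \<le> Suc (d (head T a))" if a: "a \<in> arcs T" for a
  proof -
    obtain p where "awalk (head T a) p r" "length p = d (head T a)"
      using geodesic head_in[OF a] by blast
    then show ?thesis
      using d_le[of "tail T a" "a # p"] a tail_in[OF a]
      by (auto simp: awalk_Cons_iff)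
  qed
  have parent: "\<exists>a\<in>arcs T. tail T a = v \<and> d v = Suc (d (head T a))"
    if v: "v \<in> verts T" "v \<noteq> r" for v
  proof -
    obtain p where p: "awalk v p r" "length p = d v" using geodesic[OF v(1)] by blast
    then obtain a q where aq: "p = a # q" using v(2) by (cases p) (auto simp: awalk_Nil_iff)
    then have "a \<in> arcs T" "tail T a = v" "awalk (head T a) q r"
      using p(1) by (auto simp: awalk_Cons_iff)
    then show ?thesis using d_le[of "head T a" q] triangle[of a] p(2) aq by force
  qed
  have d0: "d r = 0"
    using d_le[of r "[]"] r by (auto simp: awalk_Nil_iff)
  \<comment> \<open>The weak inequality matters: it covers both uniqueness of the parent arc and,
    below, the exclusion of arcs between vertices of equal rank.\<close>
  have le_unique: "a = b"
    if ab: "a \<in> arcs T" "b \<in> arcs T" "tail T a = tail T b"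
      "d (head T a) \<le> d (tail T a)" "d (head T b) \<le> d (tail T b)" for a b
  proof (rule ccontr)
    assume "a \<noteq> b"
    define v where "v = tail T a"
    define E where
      "E = {(tail T c, head T c) | c. c \<in> arcs T \<and> tail T c \<noteq> v \<and> head T c \<noteq> v}"
    \<comment> \<open>A shortest walk from \<open>u\<close> has rank below that of \<open>v\<close>
      from its second vertex on, and \<open>u\<close> differs from \<open>v\<close>, so the walk
      misses \<open>v\<close>.\<close>
    have to_root: "(u, r) \<in> E\<^sup>*" if "u \<in> verts T" "u \<noteq> v" "d u \<le> d v" for u
      using that
    proof (induction "d u" arbitrary: u rule: less_induct)
      case less
      show ?case
      proof (cases "u = r")
        case False
        then obtain c where c: "c \<in> arcs T" "tail T c = u" "d u = Suc (d (head T c))"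
          using parent less.prems(1) by blast
        then have "head T c \<noteq> v" using less.prems(3) by auto
        then have "(u, head T c) \<in> E" "(head T c, r) \<in> E\<^sup>*"
          using c less head_in by (auto simp: E_def)
        then show ?thesis by (rule converse_rtrancl_into_rtrancl)
      qed simp
    qed
    have "sym E"
    proof (rule symI)
      fix x y
      assume "(x, y) \<in> E"
      then obtain c where
        "c \<in> arcs T" "tail T c \<noteq> v" "head T c \<noteq> v" "x = tail T c" "y = head T c"
        by (auto simp: E_def)
      then show "(y, x) \<in> E"
        unfolding E_def using tail_arev head_arev arev_in_arcs
        by (intro CollectI exI[of _ "arev T c"]) simp
    qed
    then have "sym (E\<^sup>*)" by (rule sym_rtrancl)
    moreover have "(head T a, r) \<in> E\<^sup>*" "(head T b, r) \<in> E\<^sup>*"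
      using ab to_root head_in tail_neq_head by (simp_all add: v_def) metis+
    ultimately have "(head T a, head T b) \<in> E\<^sup>*"
      by (meson rtrancl_trans symD)
    then show False
      using neighbours_separated[OF ab(1,2) _ _ \<open>a \<noteq> b\<close> E_def] ab(3) v_def by metis
  qed
  have step: "d (tail T a) = Suc (d (head T a)) \<or> d (head T a) = Suc (d (tail T a))"
    if a: "a \<in> arcs T" for a
  proof -
    have "d (head T a) \<le> Suc (d (tail T a))"
      using triangle[OF arev_in_arcs[OF a]] tail_arev[OF a] head_arev[OF a] by simp
    moreover have "d (head T a) \<noteq> d (tail T a)"
    proof
      assume eq: "d (head T a) = d (tail T a)"
      have "tail T a \<noteq> r"
      proof
        assume "tail T a = r"
        then have "d (head T a) = 0" using eq d0 by simp
        then have "head T a = r" using parent head_in[OF a] by force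
        then show False using \<open>tail T a = r\<close> tail_neq_head[OF a] by simp
      qed
      then obtain b where b: "b \<in> arcs T" "tail T b = tail T a"
          "d (tail T a) = Suc (d (head T b))"
        using parent tail_in[OF a] by blast
      \<comment> \<open>An arc between vertices of equal rank competes with the parent arc of its
        own tail.\<close>
      have "a = b" by (rule le_unique[OF a b(1)]) (use b eq in simp_all)
      then show False using b eq by simp
    qed
    ultimately show ?thesis using triangle[OF a] by linarith
  qed
  have "tree_rank T r d"
    unfolding tree_rank_def
    by (intro conjI ballI impI d0 parent step le_unique less_imp_le)
  then show ?thesis by blast
qed

end

text \<open>
  \<open>Q v w s\<close> is read as: \<open>v\<close> may be sent to \<open>w\<close> in state \<open>s\<close>; and
  \<open>E a b s s'\<close> as: \<open>a\<close> may be sent to \<open>b\<close> with states \<open>s\<close> at the head and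
  \<open>s'\<close> at the tail.
\<close>

lemma tree_lifting:
  fixes T :: "('v, 'a) rev_digraph" and T' :: "('w, 'b) rev_digraph"
    and Q :: "'v \<Rightarrow> 'w \<Rightarrow> 's \<Rightarrow> bool" and E :: "'a \<Rightarrow> 'b \<Rightarrow> 's \<Rightarrow> 's \<Rightarrow> bool"
  assumes T: "tree_rgraph T" and T': "tree_rgraph T'"
    and r: "r \<in> verts T" "r' \<in> verts T'" "Q r r' s0"
    and step: "\<And>a w s. a \<in> arcs T \<Longrightarrow> w \<in> verts T' \<Longrightarrow> Q (head T a) w s \<Longrightarrow>
      \<exists>b s'. b \<in> arcs T' \<and> head T' b = w \<and> E a b s s' \<and> Q (tail T a) (tail T' b) s'"
    and sym: "\<And>a b s s'. a \<in> arcs T \<Longrightarrow> b \<in> arcs T' \<Longrightarrow> E a b s s' \<Longrightarrow>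
      E (arev T a) (arev T' b) s' s"
    and left_unique: "\<And>a c b s s1 s2. a \<in> arcs T \<Longrightarrow> c \<in> arcs T \<Longrightarrow> b \<in> arcs T' \<Longrightarrow>
      head T a = head T c \<Longrightarrow> Q (head T a) (head T' b) s \<Longrightarrow> E a b s s1 \<Longrightarrow> E c b s s2 \<Longrightarrow> a = c"
    and right_unique: "\<And>a b c s s1 s2. a \<in> arcs T \<Longrightarrow> b \<in> arcs T' \<Longrightarrow> c \<in> arcs T' \<Longrightarrow>
      head T' b = head T' c \<Longrightarrow> Q (head T a) (head T' b) s \<Longrightarrow> E a b s s1 \<Longrightarrow> E a c s s2 \<Longrightarrow> b = c"
    and right_total: "\<And>v b s. v \<in> verts T \<Longrightarrow> b \<in> arcs T' \<Longrightarrow> Q v (head T' b) s \<Longrightarrow>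
      \<exists>a s'. a \<in> arcs T \<and> head T a = v \<and> E a b s s'"
  obtains F S M where
    "bij_betw F (verts T) (verts T')" "bij_betw M (arcs T) (arcs T')"
    "\<And>v. v \<in> verts T \<Longrightarrow> Q v (F v) (S v)"
    "\<And>a. a \<in> arcs T \<Longrightarrow> head T' (M a) = F (head T a)"
    "\<And>a. a \<in> arcs T \<Longrightarrow> tail T' (M a) = F (tail T a)"
    "\<And>a. a \<in> arcs T \<Longrightarrow> E a (M a) (S (head T a)) (S (tail T a))"
proof -
  interpret T: rev_tree T by (rule rev_tree.intro[OF T])
  interpret T': rev_tree T' by (rule rev_tree.intro[OF T'])
  obtain d where d_rank: "tree_rank T r d"
    using T.rank_exists[OF r(1)] by blast
  have d: "d r = 0"
    "\<And>v. v \<in> verts T \<Longrightarrow> v \<noteq> r \<Longrightarrow> \<exists>a\<in>arcs T. tail T a = v \<and> d v = Suc (d (head T a))"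
    "\<And>a. a \<in> arcs T \<Longrightarrow>
      d (tail T a) = Suc (d (head T a)) \<or> d (head T a) = Suc (d (tail T a))"
    "\<And>a b. a \<in> arcs T \<Longrightarrow> b \<in> arcs T \<Longrightarrow> tail T a = tail T b \<Longrightarrow>
      d (head T a) < d (tail T a) \<Longrightarrow> d (head T b) < d (tail T b) \<Longrightarrow> a = b"
    using d_rank unfolding tree_rank_def by blast+
  obtain d' where d'_rank: "tree_rank T' r' d'"
    using T'.rank_exists[OF r(2)] by blast
  have d': "d' r' = 0"
    "\<And>v. v \<in> verts T' \<Longrightarrow> v \<noteq> r' \<Longrightarrow> \<exists>a\<in>arcs T'. tail T' a = v \<and> d' v = Suc (d' (head T' a))"
    "\<And>a. a \<in> arcs T' \<Longrightarrow>
      d' (tail T' a) = Suc (d' (head T' a)) \<or> d' (head T' a) = Suc (d' (tail T' a))"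
    "\<And>a b. a \<in> arcs T' \<Longrightarrow> b \<in> arcs T' \<Longrightarrow> tail T' a = tail T' b \<Longrightarrow>
      d' (head T' a) < d' (tail T' a) \<Longrightarrow> d' (head T' b) < d' (tail T' b) \<Longrightarrow> a = b"
    using d'_rank unfolding tree_rank_def by blast+
  obtain par where par: "\<And>v. v \<in> verts T \<Longrightarrow> v \<noteq> r \<Longrightarrow>
      par v \<in> arcs T \<and> tail T (par v) = v \<and> d v = Suc (d (head T (par v)))"
    using d(2) by metis
  have d_0: "v = r" if "v \<in> verts T" "d v = 0" for v
    using par[of v] that by auto
  \<comment> \<open>Target arc and new state are fixed once for each arc, image of its head and
    state, so that \<open>F\<close>, \<open>S\<close> and \<open>M\<close> below rely on the same
    choice.\<close>
  obtain nb ns where nb: "\<And>a w s. a \<in> arcs T \<Longrightarrow> w \<in> verts T' \<Longrightarrow> Q (head T a) w s \<Longrightarrow>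
      nb a w s \<in> arcs T' \<and> head T' (nb a w s) = w \<and> E a (nb a w s) s (ns a w s) \<and>
      Q (tail T a) (tail T' (nb a w s)) (ns a w s)"
    using step by metis
  \<comment> \<open>The recursion runs over a number instead of the tree. \<open>H n v\<close> is
    meant only for \<open>n = d v\<close>; the constant start value is correct because the root
    alone has rank 0.\<close>
  define H where "H = rec_nat (\<lambda>_. (r', s0)) (\<lambda>_ f v.
    let a = par v; w = fst (f (head T a)); s = snd (f (head T a)) in (tail T' (nb a w s), ns a w s))"
  define F where "F v = fst (H (d v) v)" for v
  define S where "S v = snd (H (d v) v)" for v
  define pb where "pb v = nb (par v) (F (head T (par v))) (S (head T (par v)))" for v
  have FS_r: "F r = r'" "S r = s0"
    by (simp_all add: F_def S_def d(1) H_def)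
  have FS_Suc: "F v = tail T' (pb v)"
    "S v = ns (par v) (F (head T (par v))) (S (head T (par v)))"
    if "v \<in> verts T" "v \<noteq> r" for v
  proof -
    have "H (Suc n) v = (let a = par v; w = fst (H n (head T a)); s = snd (H n (head T a))
        in (tail T' (nb a w s), ns a w s))" for n
      by (simp add: H_def)
    then show "F v = tail T' (pb v)"
      "S v = ns (par v) (F (head T (par v))) (S (head T (par v)))"
      using par[OF that] by (simp_all add: F_def S_def pb_def Let_def)
  qed
  have FQ: "F v \<in> verts T' \<and> Q v (F v) (S v)" if "v \<in> verts T" for v
    using that
  proof (induction "d v" arbitrary: v rule: less_induct)
    case less
    show ?case
    proof (cases "v = r")
      case False
      note p = par[OF less.prems False]
      have "F (head T (par v)) \<in> verts T'" "Q (head T (par v)) (F (head T (par v))) (S (head T (par v)))"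
        using less.hyps p T.head_in by auto
      then show ?thesis
        using nb[of "par v"] p FS_Suc[OF less.prems False] T'.tail_in by (simp add: pb_def)
    qed (simp add: FS_r r)
  qed
  have pb: "pb v \<in> arcs T'" "head T' (pb v) = F (head T (par v))" "tail T' (pb v) = F v"
      "E (par v) (pb v) (S (head T (par v))) (S v)"
    if v: "v \<in> verts T" "v \<noteq> r" for v
    using par[OF v] FQ[of "head T (par v)"] T.head_in nb[of "par v"] FS_Suc[OF v]
    by (simp_all add: pb_def)
  \<comment> \<open>An arc towards the root takes the chosen image. An arc away from the root takes
    the reverse of the image of its reverse, and \<open>sym\<close> then supplies
    \<open>E\<close>.\<close>
  define M where
    "M a = (if d (head T a) < d (tail T a) then pb (tail T a) else arev T' (pb (head T a)))" for a
  have M: "M a \<in> arcs T' \<and> head T' (M a) = F (head T a) \<and> tail T' (M a) = F (tail T a) \<and>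
      E a (M a) (S (head T a)) (S (tail T a))" if a: "a \<in> arcs T" for a
  proof (cases "d (head T a) < d (tail T a)")
    case True
    then have v: "tail T a \<in> verts T" "tail T a \<noteq> r" using d(1) T.tail_in[OF a] by auto
    have "par (tail T a) = a"
      using par[OF v] by (intro d(4) a) (use True in auto)
    then show ?thesis using pb[OF v] True by (simp add: M_def)
  next
    case False
    then have less: "d (tail T a) < d (head T a)" using d(3)[OF a] by auto
    then have v: "head T a \<in> verts T" "head T a \<noteq> r" using d(1) T.head_in[OF a] by auto
    have "par (head T a) = arev T a"
      using par[OF v] less by (intro d(4) T.arev_in_arcs a) (use T.tail_arev[OF a] T.head_arev[OF a] in auto)
    then show ?thesis
      using pb[OF v] False sym[OF _ pb(1)[OF v] pb(4)[OF v]] a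
      by (simp add: M_def T.arev_in_arcs T.arev_arev T'.arev_in_arcs T'.head_arev
          T'.tail_arev T.head_arev)
  qed
  \<comment> \<open>Only arcs with a common head are compared, so both are related to their image in
    the same state there: this is injectivity on a star.\<close>
  have M_inj: "a = c" if "a \<in> arcs T" "c \<in> arcs T" "head T a = head T c" "M a = M c" for a c
    using left_unique[of a c "M a" "S (head T a)" "S (tail T a)" "S (tail T c)"] that
      M[OF that(1)] M[OF that(2)] FQ[OF T.head_in[OF that(1)]] by simp
  \<comment> \<open>\<open>right_total\<close> provides an arc related to \<open>b\<close>;
    \<open>right_unique\<close> is needed to see that the image chosen for this arc is
    \<open>b\<close> itself.\<close>
  have M_surj: "\<exists>a\<in>arcs T. head T a = v \<and> M a = b"
    if vb: "v \<in> verts T" "b \<in> arcs T'" "head T' b = F v" for v b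
  proof -
    obtain a s' where a: "a \<in> arcs T" "head T a = v" "E a b (S v) s'"
      using right_total[OF vb(1,2), of "S v"] vb FQ[OF vb(1)] by auto
    then have "M a = b"
      using right_unique[of a "M a" b "S v"] M[OF a(1)] a vb FQ[OF vb(1)] by auto
    then show ?thesis using a by blast
  qed
  \<comment> \<open>The parent of \<open>w\<close> has a preimage by induction, and surjectivity on
    the star of this preimage lifts the parent arc of \<open>w\<close>.\<close>
  have F_surj: "\<exists>v\<in>verts T. F v = w" if "w \<in> verts T'" for w
    using that
  proof (induction "d' w" arbitrary: w rule: less_induct)
    case less
    show ?case
    proof (cases "w = r'")
      case False
      then obtain b where b: "b \<in> arcs T'" "tail T' b = w" "d' w = Suc (d' (head T' b))"
        using d'(2) less.prems by blast
      then obtain v where "v \<in> verts T" "F v = head T' b"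
        using less.hyps[of "head T' b"] T'.head_in by auto
      then obtain a where "a \<in> arcs T" "M a = b" using M_surj b by metis
      then show ?thesis using M[of a] b T.tail_in[of a] by auto
    qed (use r FS_r in auto)
  qed
  \<comment> \<open>This is the statement that the map does not fold; global injectivity follows
    from it.\<close>
  have rank_F: "d' (F v) = d v" if "v \<in> verts T" for v
    using that
  proof (induction "d v" arbitrary: v rule: less_induct)
    case less
    show ?case
    proof (cases "v = r")
      case False
      note a = par[OF less.prems False]
      define a where "a = par v"
      have a: "a \<in> arcs T" "tail T a = v" "d v = Suc (d (head T a))" using a by (simp_all add: a_def)
      note Ma = M[OF a(1)]
      have IH: "d' (F (head T a)) = d (head T a)" using less.hyps a T.head_in by auto
      \<comment> \<open>If the image of \<open>a\<close> led away from \<open>r'\<close>, then its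
        reverse and the image of the parent arc \<open>c\<close> of \<open>head T a\<close> would
        both be the parent arc of \<open>F (head T a)\<close>. Injectivity on the star of
        \<open>head T a\<close> would make \<open>a\<close> the reverse of \<open>c\<close>,
        although \<open>a\<close> leads towards \<open>r\<close>.\<close>
      have "d' (F (head T a)) \<noteq> Suc (d' (F v))"
      proof
        assume down: "d' (F (head T a)) = Suc (d' (F v))"
        then have P: "head T a \<in> verts T" "head T a \<noteq> r" using IH d(1) T.head_in[OF a(1)] by auto
        define c where "c = par (head T a)"
        have c: "c \<in> arcs T" "tail T c = head T a" "d (head T a) = Suc (d (head T c))"
          using par[OF P] by (simp_all add: c_def)
        have "d' (F (head T c)) = d (head T c)" using less.hyps a c T.head_in by auto
        then have "M c = arev T' (M a)"
          using M[OF c(1)] Ma c a IH down T'.tail_arev T'.head_arev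
          by (intro d'(4) T'.arev_in_arcs) auto
        moreover have "M (arev T c) = arev T' (M c)"
          using M[OF c(1)] M[OF T.arev_in_arcs[OF c(1)]] c(1)
          by (intro T'.arc_eqI T'.arev_in_arcs)
            (auto simp: T'.tail_arev T'.head_arev T.tail_arev T.head_arev)
        ultimately have "M (arev T c) = M a" using Ma T'.arev_arev by simp
        then have "arev T c = a"
          using a c by (intro M_inj T.arev_in_arcs) (auto simp: T.head_arev)
        then have "head T c = v" using a T.tail_arev[OF c(1)] by simp
        then show False using a c by simp
      qed
      then show ?thesis using d'(3)[of "M a"] Ma a IH by auto
    qed (simp add: FS_r d(1) d'(1))
  qed
  have F_inj: "u = v" if "u \<in> verts T" "v \<in> verts T" "F u = F v" for u v
    using that
  proof (induction "d u" arbitrary: u v rule: less_induct)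
    case less
    have duv: "d u = d v" using rank_F less.prems by metis
    show ?case
    proof (cases "u = r")
      case True
      then have "d v = 0" using d(1) duv by simp
      then show ?thesis using d_0[OF less.prems(2)] True by simp
    next
      case False
      then have "v \<noteq> r" using d_0[OF less.prems(1)] d(1) duv by metis
      note u = par[OF less.prems(1) False] and v = par[OF less.prems(2) \<open>v \<noteq> r\<close>]
      \<comment> \<open>By \<open>rank_F\<close> both images are parent arcs of the common vertex
        \<open>F u = F v\<close>.\<close>
      have "M (par u) = M (par v)"
        using u v duv less.prems M[of "par u"] M[of "par v"] rank_F T.head_in
        by (intro d'(4)) auto
      moreover from this have "head T (par u) = head T (par v)"
        using u v M[of "par u"] M[of "par v"] T.head_in by (intro less.hyps) auto
      ultimately have "par u = par v" using u v M_inj by blast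
      then show ?thesis using u v by metis
    qed
  qed
  show thesis
  proof (rule that[of F M S])
    show "bij_betw F (verts T) (verts T')"
      using FQ F_inj F_surj by (fastforce simp: bij_betw_def inj_on_def)
    show "bij_betw M (arcs T) (arcs T')"
      unfolding bij_betw_def
    proof (intro conjI inj_onI subset_antisym subsetI)
      fix a c assume ac: "a \<in> arcs T" "c \<in> arcs T" "M a = M c"
      then have "head T a = head T c"
        using M F_inj T.head_in by metis
      then show "a = c" using ac M_inj by blast
    next
      fix b assume b: "b \<in> arcs T'"
      then obtain v where "v \<in> verts T" "F v = head T' b" using F_surj T'.head_in by blast
      then show "b \<in> M ` arcs T" using M_surj[of v b] b by auto
    qed (use M in auto)
  qed (use FQ M in auto)
qed

section \<open>Adhesion maps\<close>

lemma mult_BijGroup_apply: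
  "f \<in> Bij X \<Longrightarrow> g \<in> Bij X \<Longrightarrow> x \<in> X \<Longrightarrow> (f \<otimes>\<^bsub>BijGroup X\<^esub> g) x = f (g x)"
  by (simp add: BijGroup_def compose_eq)

lemma carrier_BijGroup [simp]: "carrier (BijGroup X) = Bij X"
  by (simp add: BijGroup_def)

lemma one_BijGroup: "\<one>\<^bsub>BijGroup X\<^esub> = (\<lambda>x\<in>X. x)"
  by (simp add: BijGroup_def)

lemma Bij_image: "\<tau> \<in> Bij Y \<Longrightarrow> \<tau> ` Y = Y"
  by (simp add: Bij_def bij_betw_def)

text \<open>Modulo \<open>H\<close>, which it normalises, \<open>a\<close> has order at most two and
  coincides with its inverse. Each of the four products contains two such factors.\<close>

lemma (in group) twisted_subgroup_closed:
  assumes H: "subgroup H G" and a: "a \<in> carrier G"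
    and conj: "{a \<otimes> m \<otimes> inv a | m. m \<in> H} = H" and sq: "a \<otimes> a \<in> H"
    and m: "m \<in> H" and bc: "b \<in> {a, inv a}" "c \<in> {a, inv a}"
  shows "b \<otimes> m \<otimes> c \<in> H"
proof -
  note carr = subgroup.mem_carrier[OF H]
  have cancel: "inv a \<otimes> (a \<otimes> x) = x" if "x \<in> carrier G" for x
    using a that by (simp add: m_assoc[symmetric])
  have conj1: "a \<otimes> m \<otimes> inv a \<in> H" if "m \<in> H" for m
    using conj that by blast
  \<comment> \<open>Equality in \<open>conj\<close>, and not just inclusion, is what gives
    conjugation by the inverse.\<close>
  have conj2: "inv a \<otimes> m \<otimes> a \<in> H" if "m \<in> H" for m
  proof -
    have "m \<in> {a \<otimes> n \<otimes> inv a | n. n \<in> H}" unfolding conj by (rule that)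
    then obtain n where n: "n \<in> H" "m = a \<otimes> n \<otimes> inv a" by blast
    then have "inv a \<otimes> m \<otimes> a = n"
      using a carr[OF n(1)] by (simp add: m_assoc cancel)
    then show ?thesis using n by simp
  qed
  have aa: "a \<otimes> m \<otimes> a \<in> H" if "m \<in> H" for m
  proof -
    have "(a \<otimes> m \<otimes> inv a) \<otimes> (a \<otimes> a) = a \<otimes> m \<otimes> a"
      using a carr[OF that] by (simp add: m_assoc cancel)
    then show ?thesis using subgroup.m_closed[OF H conj1[OF that] sq] by simp
  qed
  have "inv a \<otimes> m \<otimes> inv a = inv (a \<otimes> inv m \<otimes> a)"
    using a carr[OF m] by (simp add: m_assoc inv_mult_group)
  then have "inv a \<otimes> m \<otimes> inv a \<in> H"
    using subgroup.m_inv_closed[OF H] aa m by simp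
  then show ?thesis using bc conj1 conj2 aa m by auto
qed

lemma perm_group_actionD:
  assumes "perm_group_action G X"
  shows "g \<in> G \<Longrightarrow> g \<in> Bij X"
    and "g \<in> G \<Longrightarrow> bij_betw g X X"
    and "g \<in> G \<Longrightarrow> h \<in> G \<Longrightarrow> compose X g h \<in> G"
    and "g \<in> G \<Longrightarrow> (\<lambda>x\<in>X. inv_into X g x) \<in> G"
    and "(\<lambda>x\<in>X. x) \<in> G"
proof -
  have sub: "subgroup G (BijGroup X)" using assms by (simp add: perm_group_action_def)
  show Bij: "g \<in> Bij X" if "g \<in> G" for g
    using subgroup.mem_carrier[OF sub that] by simp
  then show "g \<in> G \<Longrightarrow> bij_betw g X X" by (simp add: Bij_def)
  show "g \<in> G \<Longrightarrow> h \<in> G \<Longrightarrow> compose X g h \<in> G"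
    using subgroup.m_closed[OF sub, of g h] Bij by (simp add: BijGroup_def)
  show "g \<in> G \<Longrightarrow> (\<lambda>x\<in>X. inv_into X g x) \<in> G"
    using subgroup.m_inv_closed[OF sub, of g] Bij by (simp add: inv_BijGroup)
  show "(\<lambda>x\<in>X. x) \<in> G"
    using subgroup.one_closed[OF sub] by (simp add: one_BijGroup)
qed

text \<open>The conjugate of \<open>h\<close> belongs to the induced group, whose elements are
  restrictions. The extension \<open>m\<close> is in general not unique.\<close>

lemma perm_group_embedding_extend:
  assumes "perm_group_embedding H Y G X \<Phi>" "h \<in> H"
  shows "\<exists>m\<in>G. \<forall>y\<in>Y. m (\<Phi> y) = \<Phi> (h y)"
proof -
  have inj: "inj_on \<Phi> Y" using assms(1) by (simp add: perm_group_embedding_def)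
  have "(\<lambda>x \<in> \<Phi> ` Y. \<Phi> (h (inv_into Y \<Phi> x))) \<in> induced_perms G (\<Phi> ` Y)"
    using assms by (auto simp: perm_group_embedding_def Group.iso_def hom_def perm_group_def)
  then obtain m where "m \<in> G" "(\<lambda>x \<in> \<Phi> ` Y. \<Phi> (h (inv_into Y \<Phi> x))) = restrict m (\<Phi> ` Y)"
    by (auto simp: induced_perms_def)
  moreover from this(2) have "m (\<Phi> y) = \<Phi> (h y)" if "y \<in> Y" for y
    using inj that by (auto simp: fun_eq_iff restrict_def split: if_splits)
  ultimately show ?thesis by blast
qed

text \<open>This is surjectivity of the isomorphism onto the induced group.\<close>

lemma perm_group_embedding_restrict:
  assumes "perm_group_embedding H Y G X \<Phi>" "m \<in> G" "m ` \<Phi> ` Y = \<Phi> ` Y"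
  shows "\<exists>h\<in>H. \<forall>y\<in>Y. m (\<Phi> y) = \<Phi> (h y)"
proof -
  have inj: "inj_on \<Phi> Y" using assms(1) by (simp add: perm_group_embedding_def)
  have "restrict m (\<Phi> ` Y) \<in> induced_perms G (\<Phi> ` Y)"
    using assms(2,3) by (auto simp: induced_perms_def)
  moreover have "(\<lambda>h. \<lambda>x \<in> \<Phi> ` Y. \<Phi> (h (inv_into Y \<Phi> x))) ` H = induced_perms G (\<Phi> ` Y)"
    using assms(1)
    by (simp add: perm_group_embedding_def Group.iso_def bij_betw_def perm_group_def)
  ultimately obtain h where
    "h \<in> H" "restrict m (\<Phi> ` Y) = (\<lambda>x \<in> \<Phi> ` Y. \<Phi> (h (inv_into Y \<Phi> x)))"
    by blast
  moreover from this(2) have "m (\<Phi> y) = \<Phi> (h y)" if "y \<in> Y" for y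
    using inj that by (auto simp: fun_eq_iff restrict_def split: if_splits)
  ultimately show ?thesis by blast
qed

text \<open>The maps carried by the two directions of an arc bundle over \<open>e\<close>.\<close>

definition adhesion_pair ::
    "('v, 'a, 'x, 'y) gga \<Rightarrow> 'a \<Rightarrow> ('y \<Rightarrow> 'x) \<Rightarrow> ('y \<Rightarrow> 'x) \<Rightarrow> bool" where
  "adhesion_pair \<G> e \<psi> \<psi>' \<longleftrightarrow>
    (if self_reverse \<G> e
     then \<psi> \<in> adhesion_maps \<G> e \<and> \<psi>' \<in> twisted_adhesion_maps \<G> e \<or>
       \<psi>' \<in> adhesion_maps \<G> e \<and> \<psi> \<in> twisted_adhesion_maps \<G> e
     else \<psi> \<in> adhesion_maps \<G> e \<and> \<psi>' \<in> adhesion_maps \<G> (arev (base \<G>) e))"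

text \<open>A pair lists what is inserted before the embedding at the two ends. Both orders occur
  over a self-reverse arc because either direction may be the twisted one. The identity is written
  as a group unit so that all cases allow the same computation in \<open>BijGroup\<close>.\<close>

definition twists :: "('v, 'a, 'x, 'y) gga \<Rightarrow> 'a \<Rightarrow> (('y \<Rightarrow> 'y) \<times> ('y \<Rightarrow> 'y)) set" where
  "twists \<G> e = (let id = \<one>\<^bsub>BijGroup (aset \<G> e)\<^esub> in
    if self_reverse \<G> e then {(id, agent \<G> e), (agent \<G> e, id)} else {(id, id)})"

section \<open>Adhesion maps at the two ends of an arc\<close>

context graph_of_group_actions
begin

sublocale base: reversal_graph "base \<G>"
  using connected_base by (simp add: connected_rgraph_def)

lemma emb_in: "e \<in> arcs (base \<G>) \<Longrightarrow> y \<in> aset \<G> e \<Longrightarrow> emb \<G> e y \<in> vset \<G> (head (base \<G>) e)"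
  and emb_inj: "e \<in> arcs (base \<G>) \<Longrightarrow> inj_on (emb \<G> e) (aset \<G> e)"
  using embedding[of e] by (auto simp: perm_group_embedding_def)

lemma twists_Bij:
  assumes "e \<in> arcs (base \<G>)" "(\<tau>, \<tau>') \<in> twists \<G> e"
  shows "\<tau> \<in> Bij (aset \<G> e)" "\<tau>' \<in> Bij (aset \<G> e)"
  using assms agent_perm[of e] id_Bij[of "aset \<G> e"]
  by (auto simp: twists_def one_BijGroup Let_def split: if_splits)

text \<open>Over a self-reverse arc each of the quotients of twists to the left and right of
  \<open>m\<close> is the agent or its inverse, whichever direction is twisted in either pair;
  otherwise both are trivial. The product is the arc group element required at the far end in
  \<open>adhesion_pair_extend\<close>.\<close>

lemma twists_conjugate:
  assumes e: "e \<in> arcs (base \<G>)" and \<tau>: "(\<tau>, \<tau>') \<in> twists \<G> e" and \<sigma>: "(\<sigma>, \<sigma>') \<in> twists \<G> e"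
    and m: "m \<in> agrp \<G> e"
  shows "\<sigma>' \<otimes>\<^bsub>BijGroup (aset \<G> e)\<^esub> inv\<^bsub>BijGroup (aset \<G> e)\<^esub> \<sigma> \<otimes>\<^bsub>BijGroup (aset \<G> e)\<^esub> m
    \<otimes>\<^bsub>BijGroup (aset \<G> e)\<^esub> (\<tau> \<otimes>\<^bsub>BijGroup (aset \<G> e)\<^esub> inv\<^bsub>BijGroup (aset \<G> e)\<^esub> \<tau>') \<in> agrp \<G> e"
proof -
  interpret B: group "BijGroup (aset \<G> e)" by (rule group_BijGroup)
  have sub: "subgroup (agrp \<G> e) (BijGroup (aset \<G> e))"
    using arc_action[OF e] by (simp add: perm_group_action_def)
  show ?thesis
  proof (cases "self_reverse \<G> e")
    case True
    have a: "agent \<G> e \<in> carrier (BijGroup (aset \<G> e))"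
      using agent_perm[OF e True] by simp
    have "\<sigma>' \<otimes>\<^bsub>BijGroup (aset \<G> e)\<^esub> inv\<^bsub>BijGroup (aset \<G> e)\<^esub> \<sigma> \<in>
        {agent \<G> e, inv\<^bsub>BijGroup (aset \<G> e)\<^esub> agent \<G> e}"
      "\<tau> \<otimes>\<^bsub>BijGroup (aset \<G> e)\<^esub> inv\<^bsub>BijGroup (aset \<G> e)\<^esub> \<tau>' \<in>
        {agent \<G> e, inv\<^bsub>BijGroup (aset \<G> e)\<^esub> agent \<G> e}"
      using \<tau> \<sigma> True a by (auto simp: twists_def Let_def simp del: carrier_BijGroup)
    then show ?thesis
      using B.twisted_subgroup_closed[OF sub a agent_normalises[OF e True]
          agent_square[OF e True] m] by blast
  next
    case False
    then show ?thesis
      using \<tau> \<sigma> m subgroup.mem_carrier[OF sub m]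
      by (simp add: twists_def Let_def del: carrier_BijGroup)
  qed
qed

text \<open>A normal form common to all cases: beyond it the distinction between self-reverse and
  other arcs survives only inside \<open>twists\<close>.\<close>

lemma adhesion_pairD:
  assumes e: "e \<in> arcs (base \<G>)" and pair: "adhesion_pair \<G> e \<psi> \<psi>'"
  shows "\<exists>g\<in>vgrp \<G> (head (base \<G>) e). \<exists>g'\<in>vgrp \<G> (head (base \<G>) (arev (base \<G>) e)).
    \<exists>\<tau> \<tau>'. (\<tau>, \<tau>') \<in> twists \<G> e \<and> (\<forall>y\<in>aset \<G> e. \<psi> y = g (emb \<G> e (\<tau> y)) \<and>
      \<psi>' y = g' (emb \<G> (arev (base \<G>) e) (\<tau>' y)))"
proof (cases "self_reverse \<G> e")
  case True
  then have rev: "arev (base \<G>) e = e" by (simp add: self_reverse_def)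
  from True pair consider
    "\<psi> \<in> adhesion_maps \<G> e" "\<psi>' \<in> twisted_adhesion_maps \<G> e" |
    "\<psi>' \<in> adhesion_maps \<G> e" "\<psi> \<in> twisted_adhesion_maps \<G> e"
    by (auto simp: adhesion_pair_def)
  then show ?thesis
  proof cases
    case 1
    then obtain g g' where "g \<in> vgrp \<G> (head (base \<G>) e)" "g' \<in> vgrp \<G> (head (base \<G>) e)"
      "\<psi> = (\<lambda>y \<in> aset \<G> e. g (emb \<G> e y))" "\<psi>' = (\<lambda>y \<in> aset \<G> e. g' (emb \<G> e (agent \<G> e y)))"
      by (auto simp: adhesion_maps_def twisted_adhesion_maps_def)
    then show ?thesis
      by (intro bexI[of _ g] bexI[of _ g'] exI[of _ "\<one>\<^bsub>BijGroup (aset \<G> e)\<^esub>"]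
            exI[of _ "agent \<G> e"])
        (auto simp: rev True twists_def Let_def one_BijGroup)
  next
    case 2
    then obtain g g' where "g \<in> vgrp \<G> (head (base \<G>) e)" "g' \<in> vgrp \<G> (head (base \<G>) e)"
      "\<psi>' = (\<lambda>y \<in> aset \<G> e. g' (emb \<G> e y))" "\<psi> = (\<lambda>y \<in> aset \<G> e. g (emb \<G> e (agent \<G> e y)))"
      by (auto simp: adhesion_maps_def twisted_adhesion_maps_def)
    then show ?thesis
      by (intro bexI[of _ g] bexI[of _ g'] exI[of _ "agent \<G> e"]
            exI[of _ "\<one>\<^bsub>BijGroup (aset \<G> e)\<^esub>"])
        (auto simp: rev True twists_def Let_def one_BijGroup)
  qed
next
  case False
  then obtain g g' where
    "g \<in> vgrp \<G> (head (base \<G>) e)" "g' \<in> vgrp \<G> (head (base \<G>) (arev (base \<G>) e))"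
    "\<psi> = (\<lambda>y \<in> aset \<G> e. g (emb \<G> e y))"
    "\<psi>' = (\<lambda>y \<in> aset \<G> e. g' (emb \<G> (arev (base \<G>) e) y))"
    using pair arc_action_rev[OF e] by (auto simp: adhesion_pair_def adhesion_maps_def)
  then show ?thesis
    by (intro bexI[of _ g] bexI[of _ g'] exI[of _ "\<one>\<^bsub>BijGroup (aset \<G> e)\<^esub>"]
          exI[of _ "\<one>\<^bsub>BijGroup (aset \<G> e)\<^esub>"])
      (auto simp: False twists_def Let_def one_BijGroup)
qed

lemma adhesion_pair_inj:
  assumes e: "e \<in> arcs (base \<G>)" and pair: "adhesion_pair \<G> e \<psi> \<psi>'"
  shows "inj_on \<psi> (aset \<G> e)"
proof -
  obtain g \<tau> \<tau>' where g: "g \<in> vgrp \<G> (head (base \<G>) e)" and \<tau>: "(\<tau>, \<tau>') \<in> twists \<G> e"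
    and \<psi>: "\<And>y. y \<in> aset \<G> e \<Longrightarrow> \<psi> y = g (emb \<G> e (\<tau> y))"
    using adhesion_pairD[OF e pair] by blast
  have \<tau>_bij: "bij_betw \<tau> (aset \<G> e) (aset \<G> e)" using twists_Bij[OF e \<tau>] by (simp add: Bij_def)
  have "bij_betw g (vset \<G> (head (base \<G>) e)) (vset \<G> (head (base \<G>) e))"
    using perm_group_actionD(2)[OF vertex_action[OF base.head_in[OF e]] g] .
  then have "inj_on g (emb \<G> e ` aset \<G> e)"
    using emb_in[OF e] by (meson bij_betw_def image_subsetI inj_on_subset)
  then have "inj_on (g \<circ> emb \<G> e) (aset \<G> e)"
    using emb_inj[OF e] comp_inj_on by blast
  then have "inj_on ((g \<circ> emb \<G> e) \<circ> \<tau>) (aset \<G> e)"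
    using \<tau>_bij by (metis bij_betw_def comp_inj_on)
  then show ?thesis using \<psi> by (simp add: inj_on_def)
qed

lemma adhesion_sets_eq:
  assumes e: "e \<in> arcs (base \<G>)"
  shows "adhesion_sets \<G> e = {g ` emb \<G> e ` aset \<G> e | g. g \<in> vgrp \<G> (head (base \<G>) e)}"
  by (simp add: adhesion_sets_def adhesion_maps_def Setcompr_eq_image image_image)

text \<open>A twist permutes the colour set of the arc, so a twisted map has the image of an
  untwisted one. Hence the axiom on arcs with a given adhesion set also covers twisted
  bundles.\<close>

lemma adhesion_pair_set:
  assumes e: "e \<in> arcs (base \<G>)" and pair: "adhesion_pair \<G> e \<psi> \<psi>'"
  shows "\<psi> ` aset \<G> e \<in> adhesion_sets \<G> e"
proof -
  obtain g \<tau> \<tau>' where g: "g \<in> vgrp \<G> (head (base \<G>) e)" and \<tau>: "(\<tau>, \<tau>') \<in> twists \<G> e"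
    and \<psi>: "\<And>y. y \<in> aset \<G> e \<Longrightarrow> \<psi> y = g (emb \<G> e (\<tau> y))"
    using adhesion_pairD[OF e pair] by blast
  have "\<psi> ` aset \<G> e = (\<lambda>y. g (emb \<G> e y)) ` \<tau> ` aset \<G> e"
    using \<psi> by (auto simp: image_image)
  then have "\<psi> ` aset \<G> e = g ` emb \<G> e ` aset \<G> e"
    using Bij_image[OF twists_Bij(1)[OF e \<tau>]] by (simp add: image_image)
  then show ?thesis using g adhesion_sets_eq[OF e] by blast
qed

lemma adhesion_sets_image:
  assumes e: "e \<in> arcs (base \<G>)" and A: "A \<in> adhesion_sets \<G> e"
    and g: "g \<in> vgrp \<G> (head (base \<G>) e)"
  shows "g ` A \<in> adhesion_sets \<G> e"
proof -
  obtain h where h: "h \<in> vgrp \<G> (head (base \<G>) e)" "A = h ` emb \<G> e ` aset \<G> e"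
    using A adhesion_sets_eq[OF e] by blast
  then have "g ` A = compose (vset \<G> (head (base \<G>) e)) g h ` emb \<G> e ` aset \<G> e"
    using emb_in[OF e] by (auto simp: image_image compose_eq)
  moreover have "compose (vset \<G> (head (base \<G>) e)) g h \<in> vgrp \<G> (head (base \<G>) e)"
    by (rule perm_group_actionD(3)[OF vertex_action[OF base.head_in[OF e]] g h(1)])
  ultimately show ?thesis
    unfolding adhesion_sets_eq[OF e] by (intro CollectI exI conjI)
qed

lemma adhesion_pair_in:
  assumes e: "e \<in> arcs (base \<G>)" and pair: "adhesion_pair \<G> e \<psi> \<psi>'" and y: "y \<in> aset \<G> e"
  shows "\<psi> y \<in> vset \<G> (head (base \<G>) e)"
proof -
  obtain g \<tau> \<tau>' where g: "g \<in> vgrp \<G> (head (base \<G>) e)" and \<tau>: "(\<tau>, \<tau>') \<in> twists \<G> e"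
    and \<psi>: "\<And>y. y \<in> aset \<G> e \<Longrightarrow> \<psi> y = g (emb \<G> e (\<tau> y))"
    using adhesion_pairD[OF e pair] by blast
  have "\<tau> y \<in> aset \<G> e" using Bij_imp_funcset[OF twists_Bij(1)[OF e \<tau>]] y by blast
  then have "g (emb \<G> e (\<tau> y)) \<in> vset \<G> (head (base \<G>) e)"
    using emb_in[OF e] perm_group_actionD(2)[OF vertex_action[OF base.head_in[OF e]] g]
    by (auto dest: bij_betw_apply)
  then show ?thesis using \<psi>[OF y] by simp
qed

text \<open>
  The permutation \<open>k\<close> is forced by \<open>g\<close>; that it also extends at the other end rests on
  the agent normalising the arc group and squaring into it.
\<close>

lemma adhesion_pair_extend:
  assumes e: "e \<in> arcs (base \<G>)"
    and \<psi>: "adhesion_pair \<G> e \<psi> \<psi>'" and \<chi>: "adhesion_pair \<G> e \<chi> \<chi>'"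
    and g: "g \<in> vgrp \<G> (head (base \<G>) e)"
    and im: "g ` \<psi> ` aset \<G> e = \<chi> ` aset \<G> e"
  shows "\<exists>k g'. bij_betw k (aset \<G> e) (aset \<G> e) \<and>
    g' \<in> vgrp \<G> (head (base \<G>) (arev (base \<G>) e)) \<and>
    (\<forall>y\<in>aset \<G> e. g (\<psi> y) = \<chi> (k y) \<and> g' (\<psi>' y) = \<chi>' (k y))"
proof -
  let ?e' = "arev (base \<G>) e"
  let ?Y = "aset \<G> e"
  let ?X = "vset \<G> (head (base \<G>) e)"
  let ?X' = "vset \<G> (head (base \<G>) ?e')"
  let ?B = "BijGroup ?Y"
  interpret B: group ?B by (rule group_BijGroup)
  have e': "?e' \<in> arcs (base \<G>)" by (rule base.arev_in_arcs[OF e])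
  have Y': "aset \<G> ?e' = ?Y" "agrp \<G> ?e' = agrp \<G> e" using arc_action_rev[OF e] by auto
  note G = perm_group_actionD[OF vertex_action[OF base.head_in[OF e]]]
  note G' = perm_group_actionD[OF vertex_action[OF base.head_in[OF e']]]
  obtain g1 g3 \<tau> \<tau>' where g1: "g1 \<in> vgrp \<G> (head (base \<G>) e)"
    and g3: "g3 \<in> vgrp \<G> (head (base \<G>) ?e')" and \<tau>: "(\<tau>, \<tau>') \<in> twists \<G> e"
    and \<psi>1: "\<And>y. y \<in> ?Y \<Longrightarrow> \<psi> y = g1 (emb \<G> e (\<tau> y))"
    and \<psi>2: "\<And>y. y \<in> ?Y \<Longrightarrow> \<psi>' y = g3 (emb \<G> ?e' (\<tau>' y))"
    using adhesion_pairD[OF e \<psi>] by blast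
  obtain g2 g4 \<sigma> \<sigma>' where g2: "g2 \<in> vgrp \<G> (head (base \<G>) e)"
    and g4: "g4 \<in> vgrp \<G> (head (base \<G>) ?e')" and \<sigma>: "(\<sigma>, \<sigma>') \<in> twists \<G> e"
    and \<chi>1: "\<And>y. y \<in> ?Y \<Longrightarrow> \<chi> y = g2 (emb \<G> e (\<sigma> y))"
    and \<chi>2: "\<And>y. y \<in> ?Y \<Longrightarrow> \<chi>' y = g4 (emb \<G> ?e' (\<sigma>' y))"
    using adhesion_pairD[OF e \<chi>] by blast
  have tw: "\<tau> \<in> Bij ?Y" "\<tau>' \<in> Bij ?Y" "\<sigma> \<in> Bij ?Y" "\<sigma>' \<in> Bij ?Y"
    using twists_Bij[OF e \<tau>] twists_Bij[OF e \<sigma>] by auto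
  note map = Bij_imp_funcset[THEN funcset_mem]
  have inv_cancel: "(\<lambda>x\<in>X. inv_into X h x) (h x) = x" if "h \<in> Bij X" "x \<in> X" for h :: "'x \<Rightarrow> 'x" and X x
    using that map[OF that] by (simp add: Bij_def bij_betw_def)
  define i2 where "i2 = (\<lambda>x\<in>?X. inv_into ?X g2 x)"
  define i3 where "i3 = (\<lambda>x\<in>?X'. inv_into ?X' g3 x)"
  have i2: "i2 (g2 x) = x" if "x \<in> ?X" for x
    unfolding i2_def by (rule inv_cancel[OF G(1)[OF g2] that])
  have i3: "i3 (g3 x) = x" if "x \<in> ?X'" for x
    unfolding i3_def by (rule inv_cancel[OF G'(1)[OF g3] that])
  \<comment> \<open>\<open>n\<close> is the conjugate of \<open>g\<close> by the vertex parts,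
    \<open>g2^-1 g g1\<close>. By \<open>im\<close> it stabilises the image of the embedding, twists
    being invisible on images, and so induces an element \<open>m\<close> of the arc group.\<close>
  define n where "n = compose ?X i2 (compose ?X g g1)"
  have n: "n \<in> vgrp \<G> (head (base \<G>) e)"
    unfolding n_def i2_def by (intro G(3) G(4) g g1 g2)
  have n_apply: "n x = i2 (g (g1 x))" if "x \<in> ?X" for x
    using that by (simp add: n_def compose_eq)
  have "\<psi> ` ?Y = g1 ` emb \<G> e ` \<tau> ` ?Y" "\<chi> ` ?Y = g2 ` emb \<G> e ` \<sigma> ` ?Y"
    using \<psi>1 \<chi>1 by (auto simp: image_image)
  then have ims: "g ` g1 ` emb \<G> e ` ?Y = g2 ` emb \<G> e ` ?Y"
    using im Bij_image tw by metis
  have "n ` emb \<G> e ` ?Y = i2 ` g ` g1 ` emb \<G> e ` ?Y"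
    using n_apply emb_in[OF e] by (simp add: image_image)
  also have "\<dots> = emb \<G> e ` ?Y"
    unfolding ims using i2[OF emb_in[OF e]] by (simp add: image_image)
  finally obtain m where m: "m \<in> agrp \<G> e" "\<And>y. y \<in> ?Y \<Longrightarrow> n (emb \<G> e y) = emb \<G> e (m y)"
    using perm_group_embedding_restrict[OF embedding[OF e] n] by blast
  have m_Bij: "m \<in> Bij ?Y" using perm_group_actionD(1)[OF arc_action[OF e] m(1)] .
  have gm: "g (g1 (emb \<G> e y)) = g2 (emb \<G> e (m y))" if y: "y \<in> ?Y" for y
  proof -
    have x: "emb \<G> e y \<in> ?X" using emb_in[OF e y] .
    then have "g (g1 (emb \<G> e y)) \<in> ?X" using map[OF G(1)] g g1 by blast
    then have "g2 (n (emb \<G> e y)) = g (g1 (emb \<G> e y))"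
      using n_apply[OF x] G(2)[OF g2] by (simp add: i2_def bij_betw_inv_into_right)
    then show ?thesis using m(2)[OF y] by simp
  qed
  \<comment> \<open>This solves \<open>\<sigma> k = m \<tau>\<close>, which says that
    \<open>k\<close> transports \<open>\<psi>\<close> to \<open>\<chi>\<close> under
    \<open>g\<close>.\<close>
  define k where "k = inv\<^bsub>?B\<^esub> \<sigma> \<otimes>\<^bsub>?B\<^esub> m \<otimes>\<^bsub>?B\<^esub> \<tau>"
  \<comment> \<open>This solves \<open>m' \<tau>' = \<sigma>' k\<close>: it is what \<open>k\<close>
    looks like at the other end, where it must extend to the vertex group.\<close>
  define m' where "m' = \<sigma>' \<otimes>\<^bsub>?B\<^esub> inv\<^bsub>?B\<^esub> \<sigma> \<otimes>\<^bsub>?B\<^esub> m \<otimes>\<^bsub>?B\<^esub> (\<tau> \<otimes>\<^bsub>?B\<^esub> inv\<^bsub>?B\<^esub> \<tau>')"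
  have m': "m' \<in> agrp \<G> e"
    unfolding m'_def by (rule twists_conjugate[OF e \<tau> \<sigma> m(1)])
  have m'_Bij: "m' \<in> Bij ?Y" using perm_group_actionD(1)[OF arc_action[OF e] m'] .
  have carr: "\<tau> \<in> carrier ?B" "\<tau>' \<in> carrier ?B" "\<sigma> \<in> carrier ?B" "\<sigma>' \<in> carrier ?B" "m \<in> carrier ?B"
    using tw m_Bij by simp_all
  then have k_carr: "k \<in> carrier ?B" unfolding k_def by (intro B.m_closed B.inv_closed)
  then have k_Bij: "k \<in> Bij ?Y" by simp
  have "\<sigma> \<otimes>\<^bsub>?B\<^esub> k = m \<otimes>\<^bsub>?B\<^esub> \<tau>"
    unfolding k_def using carr
    by (simp add: B.m_assoc[symmetric] del: carrier_BijGroup)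
  then have \<sigma>k: "\<sigma> (k y) = m (\<tau> y)" if "y \<in> ?Y" for y
    using mult_BijGroup_apply[OF tw(3) k_Bij that] mult_BijGroup_apply[OF m_Bij tw(1) that] by simp
  have "m' \<otimes>\<^bsub>?B\<^esub> \<tau>' = \<sigma>' \<otimes>\<^bsub>?B\<^esub> k"
    unfolding k_def m'_def using carr by (simp add: B.m_assoc del: carrier_BijGroup)
  then have m'\<tau>: "m' (\<tau>' y) = \<sigma>' (k y)" if "y \<in> ?Y" for y
    using mult_BijGroup_apply[OF tw(4) k_Bij that] mult_BijGroup_apply[OF m'_Bij tw(2) that] by simp
  obtain n' where n': "n' \<in> vgrp \<G> (head (base \<G>) ?e')"
    "\<And>y. y \<in> ?Y \<Longrightarrow> n' (emb \<G> ?e' y) = emb \<G> ?e' (m' y)"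
    using perm_group_embedding_extend[OF embedding[OF e']] m' Y' by metis
  \<comment> \<open>The vertex parts \<open>g3\<close> and \<open>g4\<close> of the two maps at the
    far end are restored around the extension \<open>n'\<close>.\<close>
  define g' where "g' = compose ?X' g4 (compose ?X' n' i3)"
  have g': "g' \<in> vgrp \<G> (head (base \<G>) ?e')"
    unfolding g'_def i3_def by (intro G'(3) G'(4) g3 g4 n')
  have "g (\<psi> y) = \<chi> (k y)" if y: "y \<in> ?Y" for y
    using gm[OF map[OF tw(1) y]] \<psi>1[OF y] \<chi>1[OF map[OF k_Bij y]] \<sigma>k[OF y] by simp
  moreover have "g' (\<psi>' y) = \<chi>' (k y)" if y: "y \<in> ?Y" for y
  proof -
    have z: "emb \<G> ?e' (\<tau>' y) \<in> ?X'" using emb_in[OF e'] map[OF tw(2) y] Y' by simp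
    then have "g3 (emb \<G> ?e' (\<tau>' y)) \<in> ?X'" using map[OF G'(1)[OF g3]] by blast
    then have "g' (\<psi>' y) = g4 (n' (i3 (g3 (emb \<G> ?e' (\<tau>' y)))))"
      using \<psi>2[OF y] by (simp add: g'_def compose_eq)
    also have "\<dots> = g4 (emb \<G> ?e' (m' (\<tau>' y)))"
      using i3[OF z] n'(2)[OF map[OF tw(2) y]] by simp
    also have "\<dots> = \<chi>' (k y)"
      using m'\<tau>[OF y] \<chi>2[OF map[OF k_Bij y]] by simp
    finally show ?thesis .
  qed
  moreover have "bij_betw k ?Y ?Y" using k_Bij by (simp add: Bij_def)
  ultimately show ?thesis using g' by blast
qed

end

section \<open>Bundles of a scaffolding\<close>

text \<open>\<open>bundle_map\<close> and \<open>local_map\<close> are both definite descriptions of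
  this form. A bijective colouring determines the described map on \<open>Y\<close>, and
  extensionality determines it elsewhere.\<close>

lemma the_transport:
  assumes "bij_betw p B Y" "\<psi> \<in> extensional Y" "\<And>b. b \<in> B \<Longrightarrow> \<psi> (p b) = q b"
  shows "(THE \<psi>. \<psi> \<in> extensional Y \<and> (\<forall>b\<in>B. \<psi> (p b) = q b)) = \<psi>"
proof (rule the_equality)
  fix \<chi> assume \<chi>: "\<chi> \<in> extensional Y \<and> (\<forall>b\<in>B. \<chi> (p b) = q b)"
  show "\<chi> = \<psi>"
  proof (rule extensionalityI)
    fix y assume "y \<in> Y"
    then obtain b where "b \<in> B" "y = p b" using assms(1) by (auto simp: bij_betw_def)
    then show "\<chi> y = \<psi> y" using \<chi> assms(3) by simp
  qed (use \<chi> assms(2) in auto)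
qed (use assms in auto)

lemma the_transport_apply:
  assumes "bij_betw p B Y" "b \<in> B"
  shows "(THE \<psi>. \<psi> \<in> extensional Y \<and> (\<forall>b\<in>B. \<psi> (p b) = q b)) (p b) = q b"
proof -
  have inv: "inv_into B p (p c) = c" "p c \<in> Y" if "c \<in> B" for c
    using assms(1) that by (auto simp: bij_betw_def)
  have "(THE \<psi>. \<psi> \<in> extensional Y \<and> (\<forall>b\<in>B. \<psi> (p b) = q b)) = (\<lambda>y\<in>Y. q (inv_into B p y))"
    by (rule the_transport[OF assms(1)]) (simp_all add: inv)
  then show ?thesis using inv[OF assms(2)] by simp
qed

locale gga_scaffolding = graph_of_group_actions \<G> + scaffolding \<G> \<S>
  for \<G> :: "('v, 'a, 'x, 'y) gga" and \<S> :: "('v, 'a, 'x, 'y, 's, 'r) scaffold"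
begin

abbreviation "T \<equiv> quotient_graph \<S>"

sublocale S: reversal_graph "sgraph \<S>"
  by (rule reversal_graph)

sublocale T: rev_tree T
  by (rule rev_tree.intro[OF tree])

lemma verts_T: "verts T = verts (sgraph \<S>) // sim \<S>"
  and arcs_T: "arcs T = arcs (sgraph \<S>) // asim \<S>"
  by (simp_all add: quotient_graph_def)

lemma equiv_asim: "equiv (arcs (sgraph \<S>)) (asim \<S>)"
proof -
  have r: "(x, x) \<in> sim \<S>" if "x \<in> verts (sgraph \<S>)" for x
    using equiv_sim that by (meson equivE refl_onD)
  have s: "sym (sim \<S>)" and t: "trans (sim \<S>)"
    using equiv_sim by (auto simp: equiv_def)
  show ?thesis
    by (rule equivI)
      (auto simp: asim_def refl_on_def sym_def trans_def S.tail_in S.head_in r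
        intro: symD[OF s] transD[OF t])
qed

lemma vbundle_in: "x \<in> verts (sgraph \<S>) \<Longrightarrow> vbundle \<S> x \<in> verts T"
  by (simp add: verts_T quotientI)

lemma abundle_in: "b \<in> arcs (sgraph \<S>) \<Longrightarrow> abundle \<S> b \<in> arcs T"
  by (simp add: arcs_T quotientI)

lemma vbundle_self: "x \<in> verts (sgraph \<S>) \<Longrightarrow> x \<in> vbundle \<S> x"
  using equiv_class_self[OF equiv_sim] .

lemma abundle_self: "b \<in> arcs (sgraph \<S>) \<Longrightarrow> b \<in> abundle \<S> b"
  using equiv_class_self[OF equiv_asim] .

lemma in_vbundleD:
  assumes "C \<in> verts T" "x \<in> C"
  shows "x \<in> verts (sgraph \<S>)" "C = vbundle \<S> x"
proof -
  show x: "x \<in> verts (sgraph \<S>)"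
    using assms in_quotient_imp_subset[OF equiv_sim] by (auto simp: verts_T)
  show "C = vbundle \<S> x"
    using quotient_eq_iff[OF equiv_sim, of C "vbundle \<S> x" x x] assms vbundle_in[OF x]
      vbundle_self[OF x] vbundle_self x
    by (metis equiv_class_self equiv_sim Image_singleton_iff verts_T)
qed

lemma in_abundleD:
  assumes "B \<in> arcs T" "b \<in> B"
  shows "b \<in> arcs (sgraph \<S>)" "B = abundle \<S> b"
proof -
  show x: "b \<in> arcs (sgraph \<S>)"
    using assms in_quotient_imp_subset[OF equiv_asim] by (auto simp: arcs_T)
  show "B = abundle \<S> b"
    using quotient_eq_iff[OF equiv_asim, of B "abundle \<S> b" b b] assms abundle_in[OF x]
      abundle_self[OF x] abundle_self x
    by (metis equiv_class_self equiv_asim Image_singleton_iff arcs_T)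
qed

lemma vbundle_ex: "C \<in> verts T \<Longrightarrow> \<exists>x\<in>verts (sgraph \<S>). C = vbundle \<S> x"
  by (auto simp: verts_T elim: quotientE)

lemma sim_iff_vbundle:
  "x \<in> verts (sgraph \<S>) \<Longrightarrow> y \<in> verts (sgraph \<S>) \<Longrightarrow>
    (x, y) \<in> sim \<S> \<longleftrightarrow> vbundle \<S> x = vbundle \<S> y"
  using eq_equiv_class_iff[OF equiv_sim] by blast

lemma head_T:
  assumes "B \<in> arcs T" "b \<in> B"
  shows "head T B = vbundle \<S> (head (sgraph \<S>) b)"
proof -
  have *: "vbundle \<S> (head (sgraph \<S>) c) = vbundle \<S> (head (sgraph \<S>) b)" if "c \<in> B" for c
  proof -
    have "(b, c) \<in> asim \<S>" using in_abundleD[OF assms] that by auto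
    then have "(head (sgraph \<S>) b, head (sgraph \<S>) c) \<in> sim \<S>" by (simp add: asim_def)
    then show ?thesis by (rule equiv_class_eq[OF equiv_sim, symmetric])
  qed
  have "head T B = (\<Union>c\<in>B. vbundle \<S> (head (sgraph \<S>) c))"
    by (auto simp: quotient_graph_def)
  also have "\<dots> = (\<Union>c\<in>B. vbundle \<S> (head (sgraph \<S>) b))"
    by (rule SUP_cong[OF refl *])
  also have "\<dots> = vbundle \<S> (head (sgraph \<S>) b)" using assms(2) by blast
  finally show ?thesis .
qed

lemma arev_in_T: "B \<in> arcs T \<Longrightarrow> b \<in> B \<Longrightarrow> arev (sgraph \<S>) b \<in> arev T B"
  by (simp add: quotient_graph_def)

lemma head_in_bundle: "B \<in> arcs T \<Longrightarrow> b \<in> B \<Longrightarrow> head (sgraph \<S>) b \<in> head T B"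
  using head_T vbundle_self S.head_in in_abundleD(1) by auto

lemma proj:
  assumes "B \<in> arcs T"
  shows "aproj \<S> B \<in> arcs (base \<G>)"
    and "head (base \<G>) (aproj \<S> B) = vproj \<S> (head T B)"
    and "tail (base \<G>) (aproj \<S> B) = vproj \<S> (tail T B)"
    and "aproj \<S> (arev T B) = arev (base \<G>) (aproj \<S> B)"
  using proj_morphism assms by (auto simp: rgraph_morphism_def)

lemma vproj_in: "C \<in> verts T \<Longrightarrow> vproj \<S> C \<in> verts (base \<G>)"
  using proj_morphism by (auto simp: rgraph_morphism_def)

lemma bundle_map_apply:
  assumes "B \<in> arcs T" "b \<in> B"
  shows "bundle_map \<G> \<S> B (acol \<S> b) = vcol \<S> (head (sgraph \<S>) b)"
  unfolding bundle_map_def by (rule the_transport_apply[OF acol_bij[OF assms(1)] assms(2)])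

text \<open>If the projected arc is not self-reverse, neither is its reverse, so the adhesion axiom
  applies to the bundle and to the reversed bundle.\<close>

lemma adhesion_pair_bundle:
  assumes B: "B \<in> arcs T"
  shows "adhesion_pair \<G> (aproj \<S> B) (bundle_map \<G> \<S> B) (bundle_map \<G> \<S> (arev T B))"
proof (cases "self_reverse \<G> (aproj \<S> B)")
  case True
  then show ?thesis using bundle_map_self_reverse[OF B] by (auto simp: adhesion_pair_def)
next
  case False
  then have "\<not> self_reverse \<G> (aproj \<S> (arev T B))"
    using base.arev_arev proj[OF B] by (auto simp: self_reverse_def)
  then show ?thesis
    using False bundle_map_adhesion[OF B] bundle_map_adhesion[OF T.arev_in_arcs[OF B]] proj[OF B]
    by (simp add: adhesion_pair_def)
qed

text \<open>Parallel arcs lie in one bundle. There the head determines the colour, as the bundle map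
  is injective, and the colour determines the arc.\<close>

lemma no_multi_arcs:
  assumes bc: "b \<in> arcs (sgraph \<S>)" "c \<in> arcs (sgraph \<S>)"
    "tail (sgraph \<S>) b = tail (sgraph \<S>) c" "head (sgraph \<S>) b = head (sgraph \<S>) c"
  shows "b = c"
proof -
  define B where "B = abundle \<S> b"
  have B: "B \<in> arcs T" "b \<in> B" using bc abundle_in abundle_self by (auto simp: B_def)
  have "(b, b) \<in> asim \<S>" using abundle_self[OF bc(1)] by simp
  then have "(b, c) \<in> asim \<S>" using bc by (simp add: asim_def)
  then have "c \<in> B" by (simp add: B_def)
  then have "bundle_map \<G> \<S> B (acol \<S> b) = bundle_map \<G> \<S> B (acol \<S> c)"
    using bundle_map_apply B bc by simp
  moreover have "acol \<S> b \<in> aset \<G> (aproj \<S> B)" "acol \<S> c \<in> aset \<G> (aproj \<S> B)"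
    using acol_bij[OF B(1)] B(2) \<open>c \<in> B\<close> by (auto dest: bij_betw_apply)
  ultimately have "acol \<S> b = acol \<S> c"
    using adhesion_pair_inj[OF proj(1)[OF B(1)] adhesion_pair_bundle[OF B(1)]]
    by (meson inj_onD)
  then show ?thesis
    using acol_bij[OF B(1)] B(2) \<open>c \<in> B\<close> by (meson bij_betw_imp_inj_on inj_onD)
qed

lemma bundle_adhesion_set:
  "B \<in> arcs T \<Longrightarrow> bundle_map \<G> \<S> B ` aset \<G> (aproj \<S> B) \<in> adhesion_sets \<G> (aproj \<S> B)"
  using adhesion_pair_set[OF proj(1) adhesion_pair_bundle] .

lemma bundle_eqI:
  assumes "B \<in> arcs T" "D \<in> arcs T" "head T B = head T D" "aproj \<S> B = aproj \<S> D"
    "bundle_map \<G> \<S> B ` aset \<G> (aproj \<S> B) = bundle_map \<G> \<S> D ` aset \<G> (aproj \<S> D)"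
  shows "B = D"
  using unique_arc[OF T.head_in[OF assms(1)] proj(1,2)[OF assms(1)] bundle_adhesion_set[OF assms(1)]]
    assms by metis

lemma arc_exists:
  assumes "C \<in> verts T" "e \<in> arcs (base \<G>)" "head (base \<G>) e = vproj \<S> C"
    "A \<in> adhesion_sets \<G> e"
  shows "\<exists>B\<in>arcs T. head T B = C \<and> aproj \<S> B = e \<and> bundle_map \<G> \<S> B ` aset \<G> e = A"
  using ex1_implies_ex[OF unique_arc[OF assms]] by blast

text \<open>This provides a starting bundle in the second scaffolding over any given base vertex.
  Walks in the base graph lift, one arc at a time, because every arc has some adhesion set.\<close>

lemma vproj_surj:
  assumes w: "w \<in> verts (base \<G>)"
  shows "\<exists>C\<in>verts T. vproj \<S> C = w"
proof -
  obtain C where C: "C \<in> verts T"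
    using connected_rgraph_nonempty[OF T.connected] by blast
  have "reachable (pre_digraph.truncate (base \<G>)) w (vproj \<S> C)"
    using base.connected_reachable[OF connected_base w vproj_in[OF C]] .
  then show ?thesis
  proof (induction rule: base.converse_reachable_induct)
    case base
    then show ?case using C by blast
  next
    case (step x y)
    then obtain D e where D: "D \<in> verts T" "vproj \<S> D = y" and
      e: "e \<in> arcs (base \<G>)" "tail (base \<G>) e = x" "head (base \<G>) e = y"
      by (auto simp: arcs_ends_conv)
    have "(\<lambda>x\<in>vset \<G> y. x) \<in> vgrp \<G> (head (base \<G>) e)"
      using perm_group_actionD(5)[OF vertex_action[OF base.head_in[OF e(1)]]] e(3) by simp
    then have "adhesion_sets \<G> e \<noteq> {}"
      using adhesion_sets_eq[OF e(1)] by blast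
    then obtain A where "A \<in> adhesion_sets \<G> e" by blast
    then obtain B where B: "B \<in> arcs T" "head T B = D" "aproj \<S> B = e"
      using arc_exists[OF D(1) e(1)] D(2) e(3) by metis
    then show ?case using proj(3)[OF B(1)] T.tail_in[OF B(1)] e(2) by auto
  qed
qed

end

section \<open>Acceptable isomorphisms\<close>

text \<open>Replaces the definite description by the existence of a group element: the colours of a
  bundle exhaust the vertex set acted on, and group elements are extensional.\<close>

lemma acceptable_iso_alt:
  assumes "gga_scaffolding \<G> \<S>"
  shows "acceptable_iso \<G> \<S> \<S>' f \<longleftrightarrow> scaffolding_iso \<S> \<S>' f \<and>
    (\<forall>C\<in>verts (quotient_graph \<S>). \<exists>g\<in>vgrp \<G> (vproj \<S> C).
      \<forall>x\<in>C. g (vcol \<S> x) = vcol \<S>' (fst f x))"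
proof -
  interpret gga_scaffolding \<G> \<S> by fact
  have "local_map \<G> \<S> \<S>' f C \<in> vgrp \<G> (vproj \<S> C) \<longleftrightarrow>
      (\<exists>g\<in>vgrp \<G> (vproj \<S> C). \<forall>x\<in>C. g (vcol \<S> x) = vcol \<S>' (fst f x))"
    if C: "C \<in> verts T" for C
  proof
    assume "local_map \<G> \<S> \<S>' f C \<in> vgrp \<G> (vproj \<S> C)"
    moreover have "local_map \<G> \<S> \<S>' f C (vcol \<S> x) = vcol \<S>' (fst f x)" if "x \<in> C" for x
      unfolding local_map_def by (rule the_transport_apply[OF vcol_bij[OF C] that])
    ultimately show "\<exists>g\<in>vgrp \<G> (vproj \<S> C). \<forall>x\<in>C. g (vcol \<S> x) = vcol \<S>' (fst f x)"
      by blast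
  next
    assume "\<exists>g\<in>vgrp \<G> (vproj \<S> C). \<forall>x\<in>C. g (vcol \<S> x) = vcol \<S>' (fst f x)"
    then obtain g where g: "g \<in> vgrp \<G> (vproj \<S> C)" "\<And>x. x \<in> C \<Longrightarrow> g (vcol \<S> x) = vcol \<S>' (fst f x)"
      by blast
    have "g \<in> extensional (vset \<G> (vproj \<S> C))"
      using perm_group_actionD(1)[OF vertex_action[OF vproj_in[OF C]] g(1)]
      by (rule Bij_imp_extensional)
    then have "local_map \<G> \<S> \<S>' f C = g"
      unfolding local_map_def by (intro the_transport[OF vcol_bij[OF C]] g(2))
    then show "local_map \<G> \<S> \<S>' f C \<in> vgrp \<G> (vproj \<S> C)" using g(1) by simp
  qed
  then show ?thesis unfolding acceptable_iso_def by auto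
qed

section \<open>Matching the arc bundles of two scaffoldings\<close>

locale two_scaffoldings =
  A: gga_scaffolding \<G> \<S> + B: gga_scaffolding \<G> \<S>'
  for \<G> :: "('v, 'a, 'x, 'y) gga"
    and \<S> :: "('v, 'a, 'x, 'y, 's, 'r) scaffold"
    and \<S>' :: "('v, 'a, 'x, 'y, 't, 'q) scaffold"
begin

definition admits :: "'s set \<Rightarrow> 't set \<Rightarrow> ('x \<Rightarrow> 'x) \<Rightarrow> bool" where
  "admits C C' g \<longleftrightarrow> C' \<in> verts B.T \<and> vproj \<S>' C' = vproj \<S> C \<and> g \<in> vgrp \<G> (vproj \<S> C)"

text \<open>The relation \<open>E\<close> for \<open>tree_lifting\<close>, with local maps as
  states. \<open>k\<close> is the change of colours from \<open>B\<close> to \<open>B'\<close>; the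
  same \<open>k\<close> must serve both ends, since an arc and its reverse have one colour.\<close>

definition matches :: "'r set \<Rightarrow> 'q set \<Rightarrow> ('x \<Rightarrow> 'x) \<Rightarrow> ('x \<Rightarrow> 'x) \<Rightarrow> bool" where
  "matches B B' g g' \<longleftrightarrow> aproj \<S>' B' = aproj \<S> B \<and>
    (\<exists>k. bij_betw k (aset \<G> (aproj \<S> B)) (aset \<G> (aproj \<S> B)) \<and>
      (\<forall>y\<in>aset \<G> (aproj \<S> B). g (bundle_map \<G> \<S> B y) = bundle_map \<G> \<S>' B' (k y) \<and>
        g' (bundle_map \<G> \<S> (arev A.T B) y) = bundle_map \<G> \<S>' (arev B.T B') (k y)))"

lemma matches_exists:
  assumes B: "B \<in> arcs A.T" and B': "B' \<in> arcs B.T"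
    and g: "admits (head A.T B) (head B.T B') g" and p: "aproj \<S>' B' = aproj \<S> B"
    and im: "g ` bundle_map \<G> \<S> B ` aset \<G> (aproj \<S> B) =
      bundle_map \<G> \<S>' B' ` aset \<G> (aproj \<S> B)"
  shows "\<exists>g'. matches B B' g g' \<and> admits (tail A.T B) (tail B.T B') g'"
proof -
  have g_in: "g \<in> vgrp \<G> (head (base \<G>) (aproj \<S> B))"
    using g A.proj(2)[OF B] by (simp add: admits_def)
  have "adhesion_pair \<G> (aproj \<S> B) (bundle_map \<G> \<S>' B') (bundle_map \<G> \<S>' (arev B.T B'))"
    using B.adhesion_pair_bundle[OF B'] p by simp
  from A.adhesion_pair_extend[OF A.proj(1)[OF B] A.adhesion_pair_bundle[OF B] this g_in im]
  obtain k g' where k: "bij_betw k (aset \<G> (aproj \<S> B)) (aset \<G> (aproj \<S> B))"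
    and g': "g' \<in> vgrp \<G> (head (base \<G>) (arev (base \<G>) (aproj \<S> B)))"
    and eq: "\<forall>y\<in>aset \<G> (aproj \<S> B). g (bundle_map \<G> \<S> B y) = bundle_map \<G> \<S>' B' (k y) \<and>
        g' (bundle_map \<G> \<S> (arev A.T B) y) = bundle_map \<G> \<S>' (arev B.T B') (k y)"
    by blast
  have "matches B B' g g'" unfolding matches_def using p k eq by blast
  moreover have "admits (tail A.T B) (tail B.T B') g'"
    using g' A.proj[OF B] B.proj[OF B'] p B.T.tail_in[OF B'] A.base.head_arev[OF A.proj(1)[OF B]]
    by (simp add: admits_def)
  ultimately show ?thesis by blast
qed

lemma matches_sym:
  assumes B: "B \<in> arcs A.T" and B': "B' \<in> arcs B.T" and m: "matches B B' g g'"
  shows "matches (arev A.T B) (arev B.T B') g' g"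
proof -
  have "aset \<G> (arev (base \<G>) (aproj \<S> B)) = aset \<G> (aproj \<S> B)"
    using A.arc_action_rev[OF A.proj(1)[OF B]] by simp
  then show ?thesis
    using m unfolding matches_def A.proj(4)[OF B] B.proj(4)[OF B'] A.T.arev_arev[OF B]
      B.T.arev_arev[OF B'] by auto
qed

lemma matches_image:
  assumes "matches B B' g g'"
  shows "g ` bundle_map \<G> \<S> B ` aset \<G> (aproj \<S> B) = bundle_map \<G> \<S>' B' ` aset \<G> (aproj \<S> B)"
proof -
  obtain k where k: "k ` aset \<G> (aproj \<S> B) = aset \<G> (aproj \<S> B)"
    "\<And>y. y \<in> aset \<G> (aproj \<S> B) \<Longrightarrow> g (bundle_map \<G> \<S> B y) = bundle_map \<G> \<S>' B' (k y)"
    using assms by (auto simp: matches_def bij_betw_def)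
  have "g ` bundle_map \<G> \<S> B ` aset \<G> (aproj \<S> B) =
      bundle_map \<G> \<S>' B' ` k ` aset \<G> (aproj \<S> B)"
    using k(2) by (simp add: image_image)
  then show ?thesis unfolding k(1) .
qed

lemma bundle_map_image_subset:
  assumes B: "B \<in> arcs A.T"
  shows "bundle_map \<G> \<S> B ` aset \<G> (aproj \<S> B) \<subseteq> vset \<G> (vproj \<S> (head A.T B))"
  using A.adhesion_pair_in[OF A.proj(1)[OF B] A.adhesion_pair_bundle[OF B]] A.proj(2)[OF B]
  by auto

lemma admits_bij:
  assumes "C \<in> verts A.T" "admits C C' g"
  shows "bij_betw g (vset \<G> (vproj \<S> C)) (vset \<G> (vproj \<S> C))"
  using perm_group_actionD(2)[OF A.vertex_action[OF A.vproj_in[OF assms(1)]]] assms(2)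
  by (simp add: admits_def)

lemma matches_exists_right:
  assumes B: "B \<in> arcs A.T" and C': "C' \<in> verts B.T" and g: "admits (head A.T B) C' g"
  shows "\<exists>B' g'. B' \<in> arcs B.T \<and> head B.T B' = C' \<and> matches B B' g g' \<and>
    admits (tail A.T B) (tail B.T B') g'"
proof -
  note e = A.proj(1)[OF B]
  have "g \<in> vgrp \<G> (head (base \<G>) (aproj \<S> B))"
    using g A.proj(2)[OF B] by (simp add: admits_def)
  from A.adhesion_sets_image[OF e A.bundle_adhesion_set[OF B] this]
  obtain B' where B': "B' \<in> arcs B.T" "head B.T B' = C'" "aproj \<S>' B' = aproj \<S> B"
    "bundle_map \<G> \<S>' B' ` aset \<G> (aproj \<S> B) = g ` bundle_map \<G> \<S> B ` aset \<G> (aproj \<S> B)"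
    using B.arc_exists[OF C' e] A.proj(2)[OF B] g unfolding admits_def by metis
  then show ?thesis using matches_exists[OF B B'(1) _ B'(3)] g by auto
qed

text \<open>Surjectivity on stars: the adhesion set of \<open>B'\<close> is pulled back along the
  inverse of \<open>g\<close>, which again lies in the vertex group.\<close>

lemma matches_exists_left:
  assumes C: "C \<in> verts A.T" and B': "B' \<in> arcs B.T" and g: "admits C (head B.T B') g"
  shows "\<exists>B g'. B \<in> arcs A.T \<and> head A.T B = C \<and> matches B B' g g'"
proof -
  note e = B.proj(1)[OF B']
  let ?X = "vset \<G> (vproj \<S> C)"
  let ?S = "bundle_map \<G> \<S>' B' ` aset \<G> (aproj \<S>' B')"
  have h: "head (base \<G>) (aproj \<S>' B') = vproj \<S> C"
    using g B.proj(2)[OF B'] by (simp add: admits_def)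
  define i where "i = (\<lambda>x\<in>?X. inv_into ?X g x)"
  have "i \<in> vgrp \<G> (vproj \<S> C)"
    using perm_group_actionD(4)[OF A.vertex_action[OF A.vproj_in[OF C]]] g
    by (simp add: admits_def i_def)
  then have "i ` ?S \<in> adhesion_sets \<G> (aproj \<S>' B')"
    using A.adhesion_sets_image[OF e B.bundle_adhesion_set[OF B']] h by simp
  then obtain B where B: "B \<in> arcs A.T" "head A.T B = C" "aproj \<S> B = aproj \<S>' B'"
    "bundle_map \<G> \<S> B ` aset \<G> (aproj \<S>' B') = i ` ?S"
    using A.arc_exists[OF C e h] by blast
  have "?S \<subseteq> ?X"
    using A.adhesion_pair_in[OF e B.adhesion_pair_bundle[OF B']] h by auto
  then have "g (i x) = x" if "x \<in> ?S" for x
    using bij_betw_inv_into_right[OF admits_bij[OF C g]] that by (auto simp: i_def)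
  then have "g ` i ` ?S = ?S" by (simp add: image_image)
  then show ?thesis using matches_exists[OF B(1) B'] B g by metis
qed

text \<open>Injectivity on stars: \<open>g\<close> is injective, so the adhesion set of
  \<open>B'\<close> determines that of its preimage, and a bundle is determined by its head,
  projection and adhesion set.\<close>

lemma matches_left_unique:
  assumes "B \<in> arcs A.T" "D \<in> arcs A.T" "B' \<in> arcs B.T" "head A.T B = head A.T D"
    "admits (head A.T B) (head B.T B') g" "matches B B' g g1" "matches D B' g g2"
  shows "B = D"
proof -
  have p: "aproj \<S> B = aproj \<S> D" using assms(6,7) by (simp add: matches_def)
  have "inj_on g (vset \<G> (vproj \<S> (head A.T B)))"
    using admits_bij[OF A.T.head_in[OF assms(1)] assms(5)] by (simp add: bij_betw_def)
  moreover have "g ` bundle_map \<G> \<S> B ` aset \<G> (aproj \<S> B) =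
      g ` bundle_map \<G> \<S> D ` aset \<G> (aproj \<S> D)"
    using matches_image[OF assms(6)] matches_image[OF assms(7)] p by simp
  ultimately have "bundle_map \<G> \<S> B ` aset \<G> (aproj \<S> B) =
      bundle_map \<G> \<S> D ` aset \<G> (aproj \<S> D)"
    using inj_on_image_eq_iff bundle_map_image_subset[OF assms(1)]
      bundle_map_image_subset[OF assms(2)] assms(4) by metis
  then show ?thesis by (rule A.bundle_eqI[OF assms(1,2,4) p])
qed

lemma matches_right_unique:
  assumes "B' \<in> arcs B.T" "D' \<in> arcs B.T" "head B.T B' = head B.T D'"
    "matches B B' g g1" "matches B D' g g2"
  shows "B' = D'"
proof (rule B.bundle_eqI[OF assms(1-3)])
  show p: "aproj \<S>' B' = aproj \<S>' D'" using assms(4,5) by (simp add: matches_def)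
  have "aproj \<S>' B' = aproj \<S> B" using assms(4) by (simp add: matches_def)
  then show "bundle_map \<G> \<S>' B' ` aset \<G> (aproj \<S>' B') = bundle_map \<G> \<S>' D' ` aset \<G> (aproj \<S>' D')"
    using matches_image[OF assms(4)] matches_image[OF assms(5)] p by simp
qed

text \<open>The lifting may start at any bundle of the first scaffolding and any bundle of the
  second over the same base vertex, with the identity as local map.\<close>

lemma bundle_iso_exists:
  "\<exists>F S M. bij_betw F (verts A.T) (verts B.T) \<and> bij_betw M (arcs A.T) (arcs B.T) \<and>
    (\<forall>C\<in>verts A.T. admits C (F C) (S C)) \<and>
    (\<forall>B\<in>arcs A.T. head B.T (M B) = F (head A.T B) \<and> tail B.T (M B) = F (tail A.T B) \<and>
      matches B (M B) (S (head A.T B)) (S (tail A.T B)))"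
proof -
  obtain C where C: "C \<in> verts A.T"
    using connected_rgraph_nonempty[OF A.T.connected] by blast
  obtain C' where C': "C' \<in> verts B.T" "vproj \<S>' C' = vproj \<S> C"
    using B.vproj_surj[OF A.vproj_in[OF C]] by blast
  have adm: "admits C C' (\<lambda>x\<in>vset \<G> (vproj \<S> C). x)"
    using C' perm_group_actionD(5)[OF A.vertex_action[OF A.vproj_in[OF C]]]
    by (simp add: admits_def)
  show ?thesis
  proof (rule tree_lifting[OF A.tree B.tree C C'(1), of admits _ matches])
    show "admits C C' (\<lambda>x\<in>vset \<G> (vproj \<S> C). x)" by (rule adm)
    show "\<exists>B' g'. B' \<in> arcs B.T \<and> head B.T B' = D' \<and> matches B B' g g' \<and>
        admits (tail A.T B) (tail B.T B') g'"
      if "B \<in> arcs A.T" "D' \<in> verts B.T" "admits (head A.T B) D' g" for B D' g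
      using matches_exists_right that .
    show "matches (arev A.T B) (arev B.T B') g' g"
      if "B \<in> arcs A.T" "B' \<in> arcs B.T" "matches B B' g g'" for B B' g g'
      using matches_sym that .
    show "B = D" if "B \<in> arcs A.T" "D \<in> arcs A.T" "B' \<in> arcs B.T" "head A.T B = head A.T D"
      "admits (head A.T B) (head B.T B') g" "matches B B' g g1" "matches D B' g g2"
      for B D B' g g1 g2
      using matches_left_unique that .
    show "B' = D'" if "B \<in> arcs A.T" "B' \<in> arcs B.T" "D' \<in> arcs B.T"
      "head B.T B' = head B.T D'" "admits (head A.T B) (head B.T B') g"
      "matches B B' g g1" "matches B D' g g2" for B B' D' g g1 g2
      using matches_right_unique that(2-4,6-7) .
    show "\<exists>B g'. B \<in> arcs A.T \<and> head A.T B = D \<and> matches B B' g g'"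
      if "D \<in> verts A.T" "B' \<in> arcs B.T" "admits D (head B.T B') g" for D B' g
      using matches_exists_left that .
  next
    fix F S M
    assume "bij_betw F (verts A.T) (verts B.T)" "bij_betw M (arcs A.T) (arcs B.T)"
      "\<And>v. v \<in> verts A.T \<Longrightarrow> admits v (F v) (S v)"
      "\<And>a. a \<in> arcs A.T \<Longrightarrow> head B.T (M a) = F (head A.T a)"
      "\<And>a. a \<in> arcs A.T \<Longrightarrow> tail B.T (M a) = F (tail A.T a)"
      "\<And>a. a \<in> arcs A.T \<Longrightarrow> matches a (M a) (S (head A.T a)) (S (tail A.T a))"
    then show ?thesis by (intro exI[of _ F] exI[of _ S] exI[of _ M] conjI ballI)
  qed
qed

text \<open>
  As a scaffolding has no multiple arcs, the arc part of the isomorphism is determined by its vertex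
  part; this makes it compatible with reversal.
\<close>

lemma acceptable_iso_exists: "\<exists>\<Phi>. acceptable_iso \<G> \<S> \<S>' \<Phi>"
proof -
  obtain F S M where F: "bij_betw F (verts A.T) (verts B.T)"
    and M: "bij_betw M (arcs A.T) (arcs B.T)"
    and adm: "\<And>C. C \<in> verts A.T \<Longrightarrow> admits C (F C) (S C)"
    and M_ends: "\<And>B. B \<in> arcs A.T \<Longrightarrow> head B.T (M B) = F (head A.T B)"
      "\<And>B. B \<in> arcs A.T \<Longrightarrow> tail B.T (M B) = F (tail A.T B)"
    and mat: "\<And>B. B \<in> arcs A.T \<Longrightarrow> matches B (M B) (S (head A.T B)) (S (tail A.T B))"
    using bundle_iso_exists by blast
  have F_in: "F C \<in> verts B.T" if "C \<in> verts A.T" for C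
    using F that by (rule bij_betw_apply)
  have M_in: "M B \<in> arcs B.T" if "B \<in> arcs A.T" for B
    using M that by (rule bij_betw_apply)
  have p_eq: "vproj \<S>' (F C) = vproj \<S> C" if "C \<in> verts A.T" for C
    using adm[OF that] by (simp add: admits_def)
  have S_bij: "bij_betw (S C) (vset \<G> (vproj \<S> C)) (vset \<G> (vproj \<S> C))" if "C \<in> verts A.T" for C
    using admits_bij[OF that adm[OF that]] .
  have col': "bij_betw (vcol \<S>') (F C) (vset \<G> (vproj \<S> C))" if "C \<in> verts A.T" for C
    using B.vcol_bij[OF F_in[OF that]] p_eq[OF that] by simp
  \<comment> \<open>Within the bundle prescribed by \<open>F\<close>, the image is the vertex with
    the colour prescribed by \<open>S\<close>; this makes \<open>S C\<close> the local map at
    \<open>C\<close>.\<close>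
  define f where "f x = inv_into (F (vbundle \<S> x)) (vcol \<S>') (S (vbundle \<S> x) (vcol \<S> x))" for x
  have f_bij: "bij_betw f C (F C)" and f_col: "\<And>x. x \<in> C \<Longrightarrow> vcol \<S>' (f x) = S C (vcol \<S> x)"
    if C: "C \<in> verts A.T" for C
  proof -
    have f_eq: "f x = inv_into (F C) (vcol \<S>') (S C (vcol \<S> x))" if "x \<in> C" for x
      using A.in_vbundleD(2)[OF C that] by (simp add: f_def)
    have "bij_betw (inv_into (F C) (vcol \<S>') \<circ> (S C \<circ> vcol \<S>)) C (F C)"
      by (intro bij_betw_trans[OF bij_betw_trans[OF A.vcol_bij[OF C] S_bij[OF C]]]
          bij_betw_inv_into col' C)
    then show "bij_betw f C (F C)"
      by (rule bij_betw_cong[THEN iffD1, rotated]) (simp add: f_eq)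
    show "vcol \<S>' (f x) = S C (vcol \<S> x)" if x: "x \<in> C" for x
    proof -
      have "S C (vcol \<S> x) \<in> vset \<G> (vproj \<S> C)"
        using bij_betw_apply[OF S_bij[OF C] bij_betw_apply[OF A.vcol_bij[OF C] x]] .
      then show ?thesis
        unfolding f_eq[OF x] by (rule bij_betw_inv_into_right[OF col'[OF C]])
    qed
  qed
  have f_in: "f x \<in> verts (sgraph \<S>')" "vbundle \<S>' (f x) = F (vbundle \<S> x)"
    if x: "x \<in> verts (sgraph \<S>)" for x
  proof -
    have C: "vbundle \<S> x \<in> verts A.T" using A.vbundle_in[OF x] .
    have "f x \<in> F (vbundle \<S> x)"
      using bij_betw_apply[OF f_bij[OF C] A.vbundle_self[OF x]] .
    then show "f x \<in> verts (sgraph \<S>')" "vbundle \<S>' (f x) = F (vbundle \<S> x)"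
      using B.in_vbundleD[OF F_in[OF C]] by auto
  qed
  have f_verts: "bij_betw f (verts (sgraph \<S>)) (verts (sgraph \<S>'))"
  proof (rule bij_betwI')
    fix x y assume xy: "x \<in> verts (sgraph \<S>)" "y \<in> verts (sgraph \<S>)"
    show "f x = f y \<longleftrightarrow> x = y"
    proof
      assume eq: "f x = f y"
      then have "F (vbundle \<S> x) = F (vbundle \<S> y)"
        using f_in(2)[OF xy(1)] f_in(2)[OF xy(2)] by simp
      then have "vbundle \<S> x = vbundle \<S> y"
        by (rule inj_onD[OF bij_betw_imp_inj_on[OF F]]) (intro A.vbundle_in xy)+
      then have "x \<in> vbundle \<S> x" "y \<in> vbundle \<S> x"
        using A.vbundle_self xy by auto
      then show "x = y"
        by (rule inj_onD[OF bij_betw_imp_inj_on[OF f_bij[OF A.vbundle_in[OF xy(1)]]] eq])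
    qed simp
  next
    fix x assume "x \<in> verts (sgraph \<S>)"
    then show "f x \<in> verts (sgraph \<S>')" by (rule f_in)
  next
    fix x' assume x': "x' \<in> verts (sgraph \<S>')"
    then have "vbundle \<S>' x' \<in> F ` verts A.T"
      using bij_betw_imp_surj_on[OF F] B.vbundle_in by simp
    then obtain C where C: "C \<in> verts A.T" "F C = vbundle \<S>' x'" by auto
    have "x' \<in> f ` C"
      unfolding bij_betw_imp_surj_on[OF f_bij[OF C(1)]] C(2) by (rule B.vbundle_self[OF x'])
    then obtain x where "x \<in> C" "f x = x'" by blast
    then show "\<exists>x\<in>verts (sgraph \<S>). x' = f x" using A.in_vbundleD[OF C(1)] by auto
  qed
  \<comment> \<open>The equations in \<open>matches\<close> compare colours; injectivity of the
    colouring on a vertex bundle turns them into equations between vertices.\<close>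
  have ends: "\<exists>k. bij_betw k (aset \<G> (aproj \<S> B)) (aset \<G> (aproj \<S> B)) \<and>
      (\<forall>b\<in>B. \<forall>b'\<in>M B. acol \<S>' b' = k (acol \<S> b) \<longrightarrow>
        head (sgraph \<S>') b' = f (head (sgraph \<S>) b) \<and> tail (sgraph \<S>') b' = f (tail (sgraph \<S>) b))"
    if B: "B \<in> arcs A.T" for B
  proof -
    note B' = M_in[OF B]
    obtain k where k: "bij_betw k (aset \<G> (aproj \<S> B)) (aset \<G> (aproj \<S> B))"
      "\<And>y. y \<in> aset \<G> (aproj \<S> B) \<Longrightarrow>
        S (head A.T B) (bundle_map \<G> \<S> B y) = bundle_map \<G> \<S>' (M B) (k y)"
      "\<And>y. y \<in> aset \<G> (aproj \<S> B) \<Longrightarrow>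
        S (tail A.T B) (bundle_map \<G> \<S> (arev A.T B) y) = bundle_map \<G> \<S>' (arev B.T (M B)) (k y)"
      using mat[OF B] by (auto simp: matches_def)
    have col_eqI: "x' = f x"
      if "C \<in> verts A.T" "x' \<in> F C" "x \<in> C" "vcol \<S>' x' = S C (vcol \<S> x)" for C x x'
      using that f_col[OF that(1,3)] bij_betw_apply[OF f_bij[OF that(1)] that(3)]
        bij_betw_imp_inj_on[OF col'[OF that(1)]] by (metis inj_onD)
    have "head (sgraph \<S>') b' = f (head (sgraph \<S>) b)" "tail (sgraph \<S>') b' = f (tail (sgraph \<S>) b)"
      if b: "b \<in> B" "b' \<in> M B" "acol \<S>' b' = k (acol \<S> b)" for b b'
    proof -
      have y: "acol \<S> b \<in> aset \<G> (aproj \<S> B)"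
        using bij_betw_apply[OF A.acol_bij[OF B] b(1)] .
      have bs: "b \<in> arcs (sgraph \<S>)" "b' \<in> arcs (sgraph \<S>')"
        using A.in_abundleD(1)[OF B b(1)] B.in_abundleD(1)[OF B' b(2)] by auto
      show "head (sgraph \<S>') b' = f (head (sgraph \<S>) b)"
      proof (rule col_eqI[OF A.T.head_in[OF B]])
        show "head (sgraph \<S>') b' \<in> F (head A.T B)"
          using B.head_in_bundle[OF B' b(2)] M_ends(1)[OF B] by simp
        show "vcol \<S>' (head (sgraph \<S>') b') = S (head A.T B) (vcol \<S> (head (sgraph \<S>) b))"
          using B.bundle_map_apply[OF B' b(2)] A.bundle_map_apply[OF B b(1)] k(2)[OF y] b(3) by simp
      qed (rule A.head_in_bundle[OF B b(1)])
      note rB = A.T.arev_in_arcs[OF B] A.arev_in_T[OF B b(1)]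
      note rB' = B.T.arev_in_arcs[OF B'] B.arev_in_T[OF B' b(2)]
      \<comment> \<open>Tails are treated as heads of the reversed arcs, which keep their colours,
        so the second equation for \<open>k\<close> applies.\<close>
      have "head (sgraph \<S>') (arev (sgraph \<S>') b') = f (head (sgraph \<S>) (arev (sgraph \<S>) b))"
      proof (rule col_eqI[OF A.T.tail_in[OF B]])
        show "head (sgraph \<S>') (arev (sgraph \<S>') b') \<in> F (tail A.T B)"
          using B.head_in_bundle[OF rB'] M_ends(2)[OF B] B.T.head_arev[OF B'] by simp
        show "head (sgraph \<S>) (arev (sgraph \<S>) b) \<in> tail A.T B"
          using A.head_in_bundle[OF rB] A.T.head_arev[OF B] by simp
        show "vcol \<S>' (head (sgraph \<S>') (arev (sgraph \<S>') b')) =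
            S (tail A.T B) (vcol \<S> (head (sgraph \<S>) (arev (sgraph \<S>) b)))"
          using B.bundle_map_apply[OF rB'] A.bundle_map_apply[OF rB] k(3)[OF y] b(3)
            A.acol_arev[OF bs(1)] B.acol_arev[OF bs(2)] by simp
      qed
      then show "tail (sgraph \<S>') b' = f (tail (sgraph \<S>) b)"
        using A.S.head_arev[OF bs(1)] B.S.head_arev[OF bs(2)] by simp
    qed
    then show ?thesis using k(1) by blast
  qed
  have "\<exists>b'\<in>arcs (sgraph \<S>'). b' \<in> M (abundle \<S> b) \<and>
      head (sgraph \<S>') b' = f (head (sgraph \<S>) b) \<and> tail (sgraph \<S>') b' = f (tail (sgraph \<S>) b)"
    if b: "b \<in> arcs (sgraph \<S>)" for b
  proof -
    have B: "abundle \<S> b \<in> arcs A.T" using A.abundle_in[OF b] .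
    obtain k where k: "bij_betw k (aset \<G> (aproj \<S> (abundle \<S> b))) (aset \<G> (aproj \<S> (abundle \<S> b)))"
      "\<forall>c\<in>abundle \<S> b. \<forall>b'\<in>M (abundle \<S> b). acol \<S>' b' = k (acol \<S> c) \<longrightarrow>
        head (sgraph \<S>') b' = f (head (sgraph \<S>) c) \<and> tail (sgraph \<S>') b' = f (tail (sgraph \<S>) c)"
      using ends[OF B] by blast
    have "k (acol \<S> b) \<in> aset \<G> (aproj \<S> (abundle \<S> b))"
      using bij_betw_apply[OF k(1) bij_betw_apply[OF A.acol_bij[OF B] A.abundle_self[OF b]]] .
    moreover have "aproj \<S>' (M (abundle \<S> b)) = aproj \<S> (abundle \<S> b)"
      using mat[OF B] by (simp add: matches_def)
    ultimately have "k (acol \<S> b) \<in> acol \<S>' ` M (abundle \<S> b)"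
      using bij_betw_imp_surj_on[OF B.acol_bij[OF M_in[OF B]]] by simp
    then obtain b' where "b' \<in> M (abundle \<S> b)" "acol \<S>' b' = k (acol \<S> b)" by auto
    then show ?thesis using k(2) A.abundle_self[OF b] B.in_abundleD(1)[OF M_in[OF B]] by blast
  qed
  then obtain h where h: "\<And>b. b \<in> arcs (sgraph \<S>) \<Longrightarrow> h b \<in> arcs (sgraph \<S>')"
      "\<And>b. b \<in> arcs (sgraph \<S>) \<Longrightarrow> h b \<in> M (abundle \<S> b)"
      "\<And>b. b \<in> arcs (sgraph \<S>) \<Longrightarrow> head (sgraph \<S>') (h b) = f (head (sgraph \<S>) b)"
      "\<And>b. b \<in> arcs (sgraph \<S>) \<Longrightarrow> tail (sgraph \<S>') (h b) = f (tail (sgraph \<S>) b)"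
    by metis
  have f_inj: "x = y" if "f x = f y" "x \<in> verts (sgraph \<S>)" "y \<in> verts (sgraph \<S>)" for x y
    using bij_betw_imp_inj_on[OF f_verts] that by (rule inj_onD)
  have h_arcs: "bij_betw h (arcs (sgraph \<S>)) (arcs (sgraph \<S>'))"
  proof (rule bij_betwI')
    fix b c assume bc: "b \<in> arcs (sgraph \<S>)" "c \<in> arcs (sgraph \<S>)"
    show "h b = h c \<longleftrightarrow> b = c"
    proof
      assume "h b = h c"
      then show "b = c"
        using h(3,4)[OF bc(1)] h(3,4)[OF bc(2)] A.S.head_in A.S.tail_in bc
        by (intro A.no_multi_arcs bc f_inj) auto
    qed simp
  next
    fix b assume "b \<in> arcs (sgraph \<S>)"
    then show "h b \<in> arcs (sgraph \<S>')" by (rule h)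
  next
    fix b' assume b': "b' \<in> arcs (sgraph \<S>')"
    then have "abundle \<S>' b' \<in> M ` arcs A.T"
      using bij_betw_imp_surj_on[OF M] B.abundle_in by simp
    then obtain B where B: "B \<in> arcs A.T" "M B = abundle \<S>' b'" by auto
    obtain k where k: "bij_betw k (aset \<G> (aproj \<S> B)) (aset \<G> (aproj \<S> B))"
      "\<forall>b\<in>B. \<forall>b'\<in>M B. acol \<S>' b' = k (acol \<S> b) \<longrightarrow>
        head (sgraph \<S>') b' = f (head (sgraph \<S>) b) \<and> tail (sgraph \<S>') b' = f (tail (sgraph \<S>) b)"
      using ends[OF B(1)] by blast
    have b'M: "b' \<in> M B" using B.abundle_self[OF b'] B(2) by simp
    have "aproj \<S>' (M B) = aproj \<S> B" using mat[OF B(1)] by (simp add: matches_def)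
    then have "acol \<S>' b' \<in> aset \<G> (aproj \<S> B)"
      using bij_betw_apply[OF B.acol_bij[OF M_in[OF B(1)]] b'M] by simp
    then have "acol \<S>' b' \<in> (k \<circ> acol \<S>) ` B"
      using bij_betw_imp_surj_on[OF bij_betw_trans[OF A.acol_bij[OF B(1)] k(1)]] by simp
    then obtain b where b: "b \<in> B" "acol \<S>' b' = k (acol \<S> b)" by auto
    have b_arc: "b \<in> arcs (sgraph \<S>)" using A.in_abundleD(1)[OF B(1) b(1)] .
    \<comment> \<open>\<open>b\<close> was found by undoing \<open>k\<close>, so \<open>b'\<close>
      has the same ends as \<open>h b\<close>.\<close>
    have "b' = h b"
      using k(2) b b'M h[OF b_arc] by (intro B.no_multi_arcs b') auto
    then show "\<exists>b\<in>arcs (sgraph \<S>). b' = h b" using b_arc by blast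
  qed
  have h_arev: "arev (sgraph \<S>') (h b) = h (arev (sgraph \<S>) b)" if b: "b \<in> arcs (sgraph \<S>)" for b
    using h(1,3,4)[OF b] h(1,3,4)[OF A.S.arev_in_arcs[OF b]] b
    by (intro B.no_multi_arcs B.S.arev_in_arcs)
      (auto simp: B.S.head_arev B.S.tail_arev A.S.head_arev A.S.tail_arev)
  have h_bundle: "abundle \<S>' (h b) = M (abundle \<S> b)" if b: "b \<in> arcs (sgraph \<S>)" for b
    using B.in_abundleD(2)[OF M_in[OF A.abundle_in[OF b]] h(2)[OF b]] by simp
  have iso: "rgraph_iso (sgraph \<S>) (sgraph \<S>') f h"
    using f_verts h_arcs f_in(1) h h_arev by (auto simp: rgraph_iso_def rgraph_morphism_def)
  have sim: "(x, y) \<in> sim \<S> \<longleftrightarrow> (f x, f y) \<in> sim \<S>'"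
    if xy: "x \<in> verts (sgraph \<S>)" "y \<in> verts (sgraph \<S>)" for x y
  proof -
    have "vbundle \<S> x = vbundle \<S> y \<longleftrightarrow> F (vbundle \<S> x) = F (vbundle \<S> y)"
      using bij_betw_imp_inj_on[OF F] A.vbundle_in xy by (metis inj_onD)
    then show ?thesis
      using A.sim_iff_vbundle[OF xy] B.sim_iff_vbundle[of "f x" "f y"] f_in xy by metis
  qed
  have asim: "(b, c) \<in> asim \<S> \<longleftrightarrow> (h b, h c) \<in> asim \<S>'"
    if "b \<in> arcs (sgraph \<S>)" "c \<in> arcs (sgraph \<S>)" for b c
    using that h sim A.S.head_in A.S.tail_in by (simp add: asim_def)
  have "scaffolding_iso \<S> \<S>' (f, h)"
    unfolding scaffolding_iso_def fst_conv snd_conv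
  proof (intro conjI ballI)
    show "vproj \<S> (vbundle \<S> x) = vproj \<S>' (vbundle \<S>' (f x))" if "x \<in> verts (sgraph \<S>)" for x
      using p_eq[OF A.vbundle_in[OF that]] f_in(2)[OF that] by simp
    show "aproj \<S> (abundle \<S> b) = aproj \<S>' (abundle \<S>' (h b))" if "b \<in> arcs (sgraph \<S>)" for b
      using mat[OF A.abundle_in[OF that]] h_bundle[OF that] by (simp add: matches_def)
  qed (use iso sim asim in blast)+
  moreover have "S C \<in> vgrp \<G> (vproj \<S> C)" "\<forall>x\<in>C. S C (vcol \<S> x) = vcol \<S>' (f x)"
    if C: "C \<in> verts A.T" for C
    using adm[OF C] f_col[OF C] by (simp_all add: admits_def)
  ultimately have "acceptable_iso \<G> \<S> \<S>' (f, h)"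
    unfolding acceptable_iso_alt[OF A.gga_scaffolding_axioms] fst_conv by blast
  then show ?thesis by blast
qed

end

section \<open>Transport of universal groups\<close>

lemma scaffolding_iso_bij:
  assumes "scaffolding_iso \<S> \<S>' f"
  shows "bij_betw (fst f) (verts (sgraph \<S>)) (verts (sgraph \<S>'))"
    and "bij_betw (snd f) (arcs (sgraph \<S>)) (arcs (sgraph \<S>'))"
    and "x \<in> verts (sgraph \<S>) \<Longrightarrow> fst f x \<in> verts (sgraph \<S>')"
    and "b \<in> arcs (sgraph \<S>) \<Longrightarrow> snd f b \<in> arcs (sgraph \<S>')"
  using assms by (auto simp: scaffolding_iso_def rgraph_iso_def bij_betw_def)

text \<open>Local maps multiply, and vertex groups are closed under products. \<open>k\<close> need
  only agree with the composite on the graph, which allows both plain composites and their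
  extensional restrictions.\<close>

lemma acceptable_iso_compose:
  assumes S: "gga_scaffolding \<G> \<S>" and S': "gga_scaffolding \<G> \<S>'"
    and f: "acceptable_iso \<G> \<S> \<S>' f" and h: "acceptable_iso \<G> \<S>' \<S>'' h"
    and kv: "\<And>x. x \<in> verts (sgraph \<S>) \<Longrightarrow> fst k x = fst h (fst f x)"
    and ka: "\<And>b. b \<in> arcs (sgraph \<S>) \<Longrightarrow> snd k b = snd h (snd f b)"
  shows "acceptable_iso \<G> \<S> \<S>'' k"
proof -
  interpret A: gga_scaffolding \<G> \<S> by (rule S)
  interpret B: gga_scaffolding \<G> \<S>' by (rule S')
  have f_iso: "scaffolding_iso \<S> \<S>' f" and h_iso: "scaffolding_iso \<S>' \<S>'' h"
    using f h by (simp_all add: acceptable_iso_def)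
  note fb = scaffolding_iso_bij[OF f_iso] and hb = scaffolding_iso_bij[OF h_iso]
  have "scaffolding_iso \<S> \<S>'' k"
    unfolding scaffolding_iso_def rgraph_iso_def
  proof (intro conjI ballI)
    show "bij_betw (fst k) (verts (sgraph \<S>)) (verts (sgraph \<S>''))"
      using bij_betw_trans[OF fb(1) hb(1)] by (rule bij_betw_cong[THEN iffD1, rotated]) (simp add: kv)
    show "bij_betw (snd k) (arcs (sgraph \<S>)) (arcs (sgraph \<S>''))"
      using bij_betw_trans[OF fb(2) hb(2)] by (rule bij_betw_cong[THEN iffD1, rotated]) (simp add: ka)
    show "rgraph_morphism (sgraph \<S>) (sgraph \<S>'') (fst k) (snd k)"
      using f_iso h_iso fb(3,4) hb(3,4) A.S.tail_in A.S.head_in A.S.arev_in_arcs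
      by (simp add: scaffolding_iso_def rgraph_iso_def rgraph_morphism_def kv ka)
    show "(x, y) \<in> sim \<S> \<longleftrightarrow> (fst k x, fst k y) \<in> sim \<S>''"
      if "x \<in> verts (sgraph \<S>)" "y \<in> verts (sgraph \<S>)" for x y
      using f_iso h_iso fb(3) that by (simp add: scaffolding_iso_def kv)
    show "(x, y) \<in> asim \<S> \<longleftrightarrow> (snd k x, snd k y) \<in> asim \<S>''"
      if "x \<in> arcs (sgraph \<S>)" "y \<in> arcs (sgraph \<S>)" for x y
      using f_iso h_iso fb(4) that by (simp add: scaffolding_iso_def ka)
    show "vproj \<S> (vbundle \<S> x) = vproj \<S>'' (vbundle \<S>'' (fst k x))"
      if "x \<in> verts (sgraph \<S>)" for x
      using f_iso h_iso fb(3) that by (simp add: scaffolding_iso_def kv)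
    show "aproj \<S> (abundle \<S> x) = aproj \<S>'' (abundle \<S>'' (snd k x))"
      if "x \<in> arcs (sgraph \<S>)" for x
      using f_iso h_iso fb(4) that by (simp add: scaffolding_iso_def ka)
  qed
  moreover have "\<exists>g\<in>vgrp \<G> (vproj \<S> C). \<forall>x\<in>C. g (vcol \<S> x) = vcol \<S>'' (fst k x)"
    if C: "C \<in> verts A.T" for C
  proof -
    obtain x where x: "x \<in> verts (sgraph \<S>)" "C = vbundle \<S> x"
      using A.vbundle_ex[OF C] by blast
    define C' where "C' = vbundle \<S>' (fst f x)"
    have C': "C' \<in> verts B.T" using B.vbundle_in[OF fb(3)[OF x(1)]] by (simp add: C'_def)
    have p: "vproj \<S>' C' = vproj \<S> C"
      using f_iso x by (simp add: scaffolding_iso_def C'_def)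
    have f_C: "fst f y \<in> C'" if "y \<in> C" for y
      using f_iso x A.in_vbundleD(1)[OF C that] that by (simp add: scaffolding_iso_def C'_def)
    obtain g where g: "g \<in> vgrp \<G> (vproj \<S> C)" "\<And>y. y \<in> C \<Longrightarrow> g (vcol \<S> y) = vcol \<S>' (fst f y)"
      using f C unfolding acceptable_iso_alt[OF S] by blast
    obtain g' where g': "g' \<in> vgrp \<G> (vproj \<S> C)"
      "\<And>y. y \<in> C' \<Longrightarrow> g' (vcol \<S>' y) = vcol \<S>'' (fst h y)"
      using h C' p unfolding acceptable_iso_alt[OF S'] by metis
    show ?thesis
    proof (intro bexI ballI)
      show "compose (vset \<G> (vproj \<S> C)) g' g \<in> vgrp \<G> (vproj \<S> C)"
        by (rule perm_group_actionD(3)[OF A.vertex_action[OF A.vproj_in[OF C]] g'(1) g(1)])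
      show "compose (vset \<G> (vproj \<S> C)) g' g (vcol \<S> y) = vcol \<S>'' (fst k y)" if y: "y \<in> C" for y
        using bij_betw_apply[OF A.vcol_bij[OF C] y] g(2)[OF y] g'(2)[OF f_C[OF y]]
          kv[OF A.in_vbundleD(1)[OF C y]] by (simp add: compose_eq)
    qed
  qed
  ultimately show ?thesis unfolding acceptable_iso_alt[OF S] by blast
qed

text \<open>The equivalences in \<open>scaffolding_iso\<close> can be read backwards, and the local
  maps of the inverse are the inverses of those of \<open>f\<close>.\<close>

lemma acceptable_iso_inverse:
  assumes S: "gga_scaffolding \<G> \<S>" and S': "gga_scaffolding \<G> \<S>'"
    and f: "acceptable_iso \<G> \<S> \<S>' f"
  shows "acceptable_iso \<G> \<S>' \<S>
    (inv_into (verts (sgraph \<S>)) (fst f), inv_into (arcs (sgraph \<S>)) (snd f))"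
proof -
  interpret A: gga_scaffolding \<G> \<S> by (rule S)
  interpret B: gga_scaffolding \<G> \<S>' by (rule S')
  define kv where "kv = inv_into (verts (sgraph \<S>)) (fst f)"
  define ka where "ka = inv_into (arcs (sgraph \<S>)) (snd f)"
  have f_iso: "scaffolding_iso \<S> \<S>' f"
    using f by (simp add: acceptable_iso_def)
  note fb = scaffolding_iso_bij[OF f_iso]
  have kvb: "bij_betw kv (verts (sgraph \<S>')) (verts (sgraph \<S>))"
    unfolding kv_def by (rule bij_betw_inv_into[OF fb(1)])
  have kab: "bij_betw ka (arcs (sgraph \<S>')) (arcs (sgraph \<S>))"
    unfolding ka_def by (rule bij_betw_inv_into[OF fb(2)])
  have kv_in: "kv x \<in> verts (sgraph \<S>)" and f_kv: "fst f (kv x) = x"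
    if "x \<in> verts (sgraph \<S>')" for x
    using bij_betw_apply[OF kvb that] bij_betw_inv_into_right[OF fb(1) that] by (simp_all add: kv_def)
  have ka_in: "ka b \<in> arcs (sgraph \<S>)" and f_ka: "snd f (ka b) = b"
    if "b \<in> arcs (sgraph \<S>')" for b
    using bij_betw_apply[OF kab that] bij_betw_inv_into_right[OF fb(2) that] by (simp_all add: ka_def)
  have kv_f: "kv (fst f x) = x" if "x \<in> verts (sgraph \<S>)" for x
    unfolding kv_def by (rule bij_betw_inv_into_left[OF fb(1) that])
  have ka_f: "ka (snd f b) = b" if "b \<in> arcs (sgraph \<S>)" for b
    unfolding ka_def by (rule bij_betw_inv_into_left[OF fb(2) that])
  have "rgraph_morphism (sgraph \<S>') (sgraph \<S>) kv ka"
    unfolding rgraph_morphism_def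
  proof (intro conjI ballI)
    fix b assume b: "b \<in> arcs (sgraph \<S>')"
    have "tail (sgraph \<S>') (snd f (ka b)) = fst f (tail (sgraph \<S>) (ka b))"
      "head (sgraph \<S>') (snd f (ka b)) = fst f (head (sgraph \<S>) (ka b))"
      "arev (sgraph \<S>') (snd f (ka b)) = snd f (arev (sgraph \<S>) (ka b))"
      using f_iso ka_in[OF b] by (simp_all add: scaffolding_iso_def rgraph_iso_def rgraph_morphism_def)
    then show "tail (sgraph \<S>) (ka b) = kv (tail (sgraph \<S>') b)"
      "head (sgraph \<S>) (ka b) = kv (head (sgraph \<S>') b)"
      "arev (sgraph \<S>) (ka b) = ka (arev (sgraph \<S>') b)"
      using kv_f A.S.tail_in A.S.head_in ka_f A.S.arev_in_arcs ka_in[OF b] f_ka[OF b] by simp_all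
  qed (use kv_in ka_in in auto)
  moreover have "(x, y) \<in> sim \<S>' \<longleftrightarrow> (kv x, kv y) \<in> sim \<S>"
    if xy: "x \<in> verts (sgraph \<S>')" "y \<in> verts (sgraph \<S>')" for x y
  proof -
    have "(kv x, kv y) \<in> sim \<S> \<longleftrightarrow> (fst f (kv x), fst f (kv y)) \<in> sim \<S>'"
      using f_iso kv_in[OF xy(1)] kv_in[OF xy(2)] by (simp add: scaffolding_iso_def)
    then show ?thesis using f_kv[OF xy(1)] f_kv[OF xy(2)] by simp
  qed
  moreover have "(x, y) \<in> asim \<S>' \<longleftrightarrow> (ka x, ka y) \<in> asim \<S>"
    if xy: "x \<in> arcs (sgraph \<S>')" "y \<in> arcs (sgraph \<S>')" for x y
  proof -
    have "(ka x, ka y) \<in> asim \<S> \<longleftrightarrow> (snd f (ka x), snd f (ka y)) \<in> asim \<S>'"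
      using f_iso ka_in[OF xy(1)] ka_in[OF xy(2)] by (simp add: scaffolding_iso_def)
    then show ?thesis using f_ka[OF xy(1)] f_ka[OF xy(2)] by simp
  qed
  moreover have vp: "vproj \<S>' (vbundle \<S>' x) = vproj \<S> (vbundle \<S> (kv x))"
    if x: "x \<in> verts (sgraph \<S>')" for x
  proof -
    have "vproj \<S> (vbundle \<S> (kv x)) = vproj \<S>' (vbundle \<S>' (fst f (kv x)))"
      using f_iso kv_in[OF x] by (simp add: scaffolding_iso_def)
    then show ?thesis using f_kv[OF x] by simp
  qed
  moreover have "aproj \<S>' (abundle \<S>' b) = aproj \<S> (abundle \<S> (ka b))"
    if b: "b \<in> arcs (sgraph \<S>')" for b
  proof -
    have "aproj \<S> (abundle \<S> (ka b)) = aproj \<S>' (abundle \<S>' (snd f (ka b)))"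
      using f_iso ka_in[OF b] by (simp add: scaffolding_iso_def)
    then show ?thesis using f_ka[OF b] by simp
  qed
  ultimately have "scaffolding_iso \<S>' \<S> (kv, ka)"
    unfolding scaffolding_iso_def rgraph_iso_def fst_conv snd_conv
    using kvb kab by blast
  moreover have "\<exists>g\<in>vgrp \<G> (vproj \<S>' C'). \<forall>x\<in>C'. g (vcol \<S>' x) = vcol \<S> (kv x)"
    if C': "C' \<in> verts B.T" for C'
  proof -
    obtain x where x: "x \<in> verts (sgraph \<S>')" "C' = vbundle \<S>' x"
      using B.vbundle_ex[OF C'] by blast
    define C where "C = vbundle \<S> (kv x)"
    have C: "C \<in> verts A.T" using A.vbundle_in[OF kv_in[OF x(1)]] by (simp add: C_def)
    have p: "vproj \<S>' C' = vproj \<S> C" using vp[OF x(1)] x(2) by (simp add: C_def)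
    have kv_C: "kv y \<in> C" if y: "y \<in> C'" for y
    proof -
      have "(fst f (kv x), fst f (kv y)) \<in> sim \<S>'"
        using y x f_kv B.in_vbundleD(1)[OF C' y] by simp
      then show ?thesis
        using f_iso kv_in[OF x(1)] kv_in[OF B.in_vbundleD(1)[OF C' y]]
        by (simp add: scaffolding_iso_def C_def)
    qed
    obtain g where g: "g \<in> vgrp \<G> (vproj \<S> C)" "\<And>y. y \<in> C \<Longrightarrow> g (vcol \<S> y) = vcol \<S>' (fst f y)"
      using f C unfolding acceptable_iso_alt[OF S] by blast
    let ?X = "vset \<G> (vproj \<S> C)"
    note G = perm_group_actionD[OF A.vertex_action[OF A.vproj_in[OF C]]]
    have "(\<lambda>x\<in>?X. inv_into ?X g x) (vcol \<S>' y) = vcol \<S> (kv y)" if y: "y \<in> C'" for y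
    proof -
      have z: "vcol \<S> (kv y) \<in> ?X" using bij_betw_apply[OF A.vcol_bij[OF C] kv_C[OF y]] .
      have "g (vcol \<S> (kv y)) = vcol \<S>' y"
        using g(2)[OF kv_C[OF y]] f_kv[OF B.in_vbundleD(1)[OF C' y]] by simp
      then show ?thesis
        using bij_betw_inv_into_left[OF G(2)[OF g(1)] z] bij_betw_apply[OF G(2)[OF g(1)] z] by simp
    qed
    then show ?thesis using G(4)[OF g(1)] p by metis
  qed
  ultimately have "acceptable_iso \<G> \<S>' \<S> (kv, ka)"
    unfolding acceptable_iso_alt[OF S'] by simp
  then show ?thesis by (simp add: kv_def ka_def)
qed

text \<open>The inverse \<open>\<Psi>\<close> is a separate argument, so that conjugating back is
  the same construction with the roles exchanged. The restriction makes the result extensional, as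
  elements of the universal group are.\<close>

definition conjugate_map ::
    "('v, 'a, 'x, 'y, 't, 'q) scaffold \<Rightarrow> ('s \<Rightarrow> 't) \<times> ('r \<Rightarrow> 'q) \<Rightarrow> ('t \<Rightarrow> 's) \<times> ('q \<Rightarrow> 'r) \<Rightarrow>
      ('s \<Rightarrow> 's) \<times> ('r \<Rightarrow> 'r) \<Rightarrow> ('t \<Rightarrow> 't) \<times> ('q \<Rightarrow> 'q)" where
  "conjugate_map \<S>' \<Phi> \<Psi> g =
    ((\<lambda>x\<in>verts (sgraph \<S>'). fst \<Phi> (fst g (fst \<Psi> x))),
     (\<lambda>b\<in>arcs (sgraph \<S>'). snd \<Phi> (snd g (snd \<Psi> b))))"

lemma carrier_universal_group:
  "carrier (universal_group \<G> \<S>) =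
    {f \<in> Bij (verts (sgraph \<S>)) \<times> Bij (arcs (sgraph \<S>)). acceptable_iso \<G> \<S> \<S> f}"
  by (simp add: universal_group_def)

lemma mult_universal_group:
  assumes "g \<in> carrier (universal_group \<G> \<S>)" "h \<in> carrier (universal_group \<G> \<S>)"
  shows "g \<otimes>\<^bsub>universal_group \<G> \<S>\<^esub> h =
    (compose (verts (sgraph \<S>)) (fst g) (fst h), compose (arcs (sgraph \<S>)) (snd g) (snd h))"
  using assms
  by (auto simp: carrier_universal_group universal_group_def DirProd_def BijGroup_def)

lemma universal_group_apply:
  assumes "g \<in> carrier (universal_group \<G> \<S>)"
  shows "x \<in> verts (sgraph \<S>) \<Longrightarrow> fst g x \<in> verts (sgraph \<S>)"
    and "b \<in> arcs (sgraph \<S>) \<Longrightarrow> snd g b \<in> arcs (sgraph \<S>)"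
  using assms by (auto simp: carrier_universal_group Bij_def bij_betw_def)

lemma conjugate_map_in:
  assumes S: "gga_scaffolding \<G> \<S>" and S': "gga_scaffolding \<G> \<S>'"
    and \<Phi>: "acceptable_iso \<G> \<S> \<S>' \<Phi>" and \<Psi>: "acceptable_iso \<G> \<S>' \<S> \<Psi>"
    and g: "g \<in> carrier (universal_group \<G> \<S>)"
  shows "conjugate_map \<S>' \<Phi> \<Psi> g \<in> carrier (universal_group \<G> \<S>')"
proof -
  have "acceptable_iso \<G> \<S> \<S> g" using g by (simp add: carrier_universal_group)
  then have "acceptable_iso \<G> \<S>' \<S> (fst g \<circ> fst \<Psi>, snd g \<circ> snd \<Psi>)"
    by (rule acceptable_iso_compose[OF S' S \<Psi>]) simp_all
  from acceptable_iso_compose[OF S' S this \<Phi>]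
  have acc: "acceptable_iso \<G> \<S>' \<S>' (conjugate_map \<S>' \<Phi> \<Psi> g)"
    by (simp add: conjugate_map_def)
  then have "scaffolding_iso \<S>' \<S>' (conjugate_map \<S>' \<Phi> \<Psi> g)" by (simp add: acceptable_iso_def)
  from scaffolding_iso_bij(1,2)[OF this] acc show ?thesis
    by (simp add: carrier_universal_group Bij_def conjugate_map_def mem_Times_iff)
qed

text \<open>On the graph the inner factors cancel; off the graph both sides agree by
  extensionality.\<close>

lemma conjugate_map_inverse:
  assumes \<Phi>: "scaffolding_iso \<S> \<S>' \<Phi>"
    and inv: "\<And>x. x \<in> verts (sgraph \<S>) \<Longrightarrow> fst \<Psi> (fst \<Phi> x) = x"
      "\<And>b. b \<in> arcs (sgraph \<S>) \<Longrightarrow> snd \<Psi> (snd \<Phi> b) = b"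
    and g: "g \<in> carrier (universal_group \<G> \<S>)"
  shows "conjugate_map \<S> \<Psi> \<Phi> (conjugate_map \<S>' \<Phi> \<Psi> g) = g"
proof (rule prod_eqI)
  have ext: "fst g \<in> extensional (verts (sgraph \<S>))" "snd g \<in> extensional (arcs (sgraph \<S>))"
    using g by (auto simp: carrier_universal_group Bij_def)
  note simps = conjugate_map_def inv universal_group_apply[OF g] scaffolding_iso_bij(3,4)[OF \<Phi>]
  show "fst (conjugate_map \<S> \<Psi> \<Phi> (conjugate_map \<S>' \<Phi> \<Psi> g)) = fst g"
    by (rule extensionalityI[OF _ ext(1)]) (simp_all add: simps)
  show "snd (conjugate_map \<S> \<Psi> \<Phi> (conjugate_map \<S>' \<Phi> \<Psi> g)) = snd g"
    by (rule extensionalityI[OF _ ext(2)]) (simp_all add: simps)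
qed

text \<open>Conjugation by \<open>\<Phi>\<close> is the isomorphism: the factors
  \<open>\<Psi>\<close> and \<open>\<Phi>\<close> between two conjugates cancel, and the same
  cancellation gives equivariance.\<close>

lemma universal_group_iso:
  assumes S: "gga_scaffolding \<G> \<S>" and S': "gga_scaffolding \<G> \<S>'"
    and \<Phi>: "acceptable_iso \<G> \<S> \<S>' \<Phi>"
  shows "\<exists>\<phi>\<in>Group.iso (universal_group \<G> \<S>) (universal_group \<G> \<S>').
    \<forall>g\<in>carrier (universal_group \<G> \<S>).
      (\<forall>x\<in>verts (sgraph \<S>). fst (\<phi> g) (fst \<Phi> x) = fst \<Phi> (fst g x)) \<and>
      (\<forall>x\<in>arcs (sgraph \<S>). snd (\<phi> g) (snd \<Phi> x) = snd \<Phi> (snd g x))"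
proof -
  define \<Psi> where
    "\<Psi> = (inv_into (verts (sgraph \<S>)) (fst \<Phi>), inv_into (arcs (sgraph \<S>)) (snd \<Phi>))"
  have \<Psi>: "acceptable_iso \<G> \<S>' \<S> \<Psi>"
    unfolding \<Psi>_def by (rule acceptable_iso_inverse[OF S S' \<Phi>])
  have \<Phi>_iso: "scaffolding_iso \<S> \<S>' \<Phi>" and \<Psi>_iso: "scaffolding_iso \<S>' \<S> \<Psi>"
    using \<Phi> \<Psi> by (simp_all add: acceptable_iso_def)
  note \<Phi>b = scaffolding_iso_bij[OF \<Phi>_iso] and \<Psi>b = scaffolding_iso_bij[OF \<Psi>_iso]
  have inv: "\<And>x. x \<in> verts (sgraph \<S>) \<Longrightarrow> fst \<Psi> (fst \<Phi> x) = x"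
      "\<And>b. b \<in> arcs (sgraph \<S>) \<Longrightarrow> snd \<Psi> (snd \<Phi> b) = b"
    using bij_betw_inv_into_left[OF \<Phi>b(1)] bij_betw_inv_into_left[OF \<Phi>b(2)]
    by (simp_all add: \<Psi>_def)
  have inv': "\<And>x. x \<in> verts (sgraph \<S>') \<Longrightarrow> fst \<Phi> (fst \<Psi> x) = x"
      "\<And>b. b \<in> arcs (sgraph \<S>') \<Longrightarrow> snd \<Phi> (snd \<Psi> b) = b"
    using bij_betw_inv_into_right[OF \<Phi>b(1)] bij_betw_inv_into_right[OF \<Phi>b(2)]
    by (simp_all add: \<Psi>_def)
  let ?U = "universal_group \<G> \<S>" and ?U' = "universal_group \<G> \<S>'"
  let ?\<phi> = "conjugate_map \<S>' \<Phi> \<Psi>"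
  have in_U': "?\<phi> g \<in> carrier ?U'" if "g \<in> carrier ?U" for g
    by (rule conjugate_map_in[OF S S' \<Phi> \<Psi> that])
  have in_U: "conjugate_map \<S> \<Psi> \<Phi> g \<in> carrier ?U" if "g \<in> carrier ?U'" for g
    by (rule conjugate_map_in[OF S' S \<Psi> \<Phi> that])
  have "bij_betw ?\<phi> (carrier ?U) (carrier ?U')"
  proof (rule bij_betw_byWitness[where f' = "conjugate_map \<S> \<Psi> \<Phi>"])
    show "\<forall>g\<in>carrier ?U. conjugate_map \<S> \<Psi> \<Phi> (?\<phi> g) = g"
      using conjugate_map_inverse[OF \<Phi>_iso inv] by blast
    show "\<forall>g\<in>carrier ?U'. ?\<phi> (conjugate_map \<S> \<Psi> \<Phi> g) = g"
      using conjugate_map_inverse[OF \<Psi>_iso inv'] by blast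
  qed (use in_U in_U' in auto)
  moreover have "?\<phi> (g \<otimes>\<^bsub>?U\<^esub> h) = ?\<phi> g \<otimes>\<^bsub>?U'\<^esub> ?\<phi> h"
    if g: "g \<in> carrier ?U" and h: "h \<in> carrier ?U" for g h
    unfolding mult_universal_group[OF g h] mult_universal_group[OF in_U'[OF g] in_U'[OF h]]
    using \<Psi>b(3,4) \<Phi>b(3,4) universal_group_apply[OF g] universal_group_apply[OF h] inv
    by (auto simp: conjugate_map_def compose_def fun_eq_iff restrict_def)
  ultimately have "?\<phi> \<in> Group.iso ?U ?U'"
    using in_U' by (auto simp: Group.iso_def hom_def)
  moreover have "fst (?\<phi> g) (fst \<Phi> x) = fst \<Phi> (fst g x)" if "x \<in> verts (sgraph \<S>)" for g x
    using \<Phi>b(3)[OF that] inv(1)[OF that] by (simp add: conjugate_map_def)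
  moreover have "snd (?\<phi> g) (snd \<Phi> x) = snd \<Phi> (snd g x)" if "x \<in> arcs (sgraph \<S>)" for g x
    using \<Phi>b(4)[OF that] inv(2)[OF that] by (simp add: conjugate_map_def)
  ultimately show ?thesis by blast
qed

theorem theorem6p1:
  fixes \<G> :: "('v, 'a, 'x, 'y) gga"
    and \<Sigma> :: "('v, 'a, 'x, 'y, 's, 'r) scaffold"
    and \<Sigma>' :: "('v, 'a, 'x, 'y, 't, 'q) scaffold"
  assumes "graph_of_group_actions \<G>"
    and "scaffolding \<G> \<Sigma>"
    and "scaffolding \<G> \<Sigma>'"
  shows "\<exists>\<Phi> \<phi>. acceptable_iso \<G> \<Sigma> \<Sigma>' \<Phi> \<and>
    \<phi> \<in> Group.iso (universal_group \<G> \<Sigma>) (universal_group \<G> \<Sigma>') \<and>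
    (\<forall>g\<in>carrier (universal_group \<G> \<Sigma>).
      (\<forall>x\<in>verts (sgraph \<Sigma>). fst (\<phi> g) (fst \<Phi> x) = fst \<Phi> (fst g x)) \<and>
      (\<forall>x\<in>arcs (sgraph \<Sigma>). snd (\<phi> g) (snd \<Phi> x) = snd \<Phi> (snd g x)))"
proof -
  have S: "gga_scaffolding \<G> \<Sigma>" and S': "gga_scaffolding \<G> \<Sigma>'"
    using assms by (simp_all add: gga_scaffolding_def)
  interpret two_scaffoldings \<G> \<Sigma> \<Sigma>'
    by (rule two_scaffoldings.intro[OF S S'])
  obtain \<Phi> where \<Phi>: "acceptable_iso \<G> \<Sigma> \<Sigma>' \<Phi>"
    using acceptable_iso_exists by blast
  then show ?thesis using universal_group_iso[OF S S' \<Phi>] by blast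
qed

end
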